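(* Let $\nu$ be a probability measure on $\mathbb{T}^p\times\mathbb{T}^d$ and $f_0\in H$. Let $f_*$ be the minimizer of $\mathcal{J}_\nu$ in $H$ and let $(f_m)_{m\in\mathbb{N}}$ be a sequence produced by the greedy algorithm for $\nu$ started from $f_0$. Then $$\|f_m-f_*\|_{H^1}\longrightarrow 0\qquad\text{as }m\to+\infty.$$
   Context: $\mathbb{T}=\mathbb{R}/\mathbb{Z}$, $D=p+d\ge 3$ with integers $p,d\ge 1$, $\mathbb{T}^D=\mathbb{T}^p\times\mathbb{T}^d$; points are written $(q,y)$ with $q\in\mathbb{T}^p$ and $y\in\mathbb{T}^d$. Standing assumptions: $V\in\mathcal{C}^\infty(\mathbb{T}^D)$, $\lambda\ge 0$, and $K\in\mathcal{C}^\infty(\mathbb{T}^d\times\mathbb{T}^d,\mathbb{R}_+)$ satisfies $\int_{\mathbb{T}^d}K(y,z)\,dz=1$ and $K(y,z)=K(z,y)$ for all $y,z\in\mathbb{T}^d$; moreover either $K>0$ everywhere or $\lambda>0$. $H=\{f\in H^1(\mathbb{T}^d):\int_{\mathbb{T}^d}f(z)\,dz=0\}$. For a probability measure $\nu$ on $\mathbb{T}^p\times\mathbb{T}^d$ and $f\in H$, $$\mathcal{J}_\nu(f)=\int_{\mathbb{T}^p\times\mathbb{T}^d\times\mathbb{T}^d}|\nabla_yV(q,y)-\nabla f(z)|^2K(y,z)\,dz\,d\nu(q,y)+\lambda\int_{\mathbb{T}^d}|\nabla f(z)|^2\,dz,$$ where $\nabla_yV$ is the gradient of $V$ in its last $d$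 variables. Under the standing assumptions, $\mathcal{J}_\nu$ has a unique minimizer in $H$. For $r_1,\dots,r_d\in H^1(\mathbb{T})$, $\bigotimes_{j=1}^dr_j$ is the function $z\mapsto\prod_{j=1}^dr_j(z_j)$ on $\mathbb{T}^d$. For $i\in\{1,\dots,d\}$, $$\Sigma_i=\Big\{g\in H:\ g=\bigotimes_{j=1}^dr_j\text{ with }r_j\in H^1(\mathbb{T})\text{ for all }j\in\{1,\dots,d\}\text{ and }\int_{\mathbb{T}}r_i(z_i)\,dz_i=0\Big\}.$$ Minimizers of $g\mapsto\mathcal{J}_\nu(f+g)$ over $\Sigma_i$ exist for all $f\in H$ and all $i$. Greedy algorithm for $\nu$ started from $f_0\in H$: for $n=0,1,2,\dots$, cycling through $i=1,2,\dots,d,1,2,\dots$ (i.e. $i=i(n)=(n\bmod d)+1$), let $g_n$ be any minimizer of $g\mapsto\mathcal{J}_\nu(f_n+g)$ over $\Sigma_{i(n)}$, and set $f_{n+1}=f_n+g_n$. *)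

theory Defs
  imports "HOL-Probability.Probability"
begin

(* The torus T^n = R^n/Z^n: functions on it are the Z^n-periodic functions on R^n, and measures
   on it are measures on R^n concentrated on the half-open unit cube, which is a measurable set of
   representatives.  The dimension is that of a euclidean space, so that T (type real),
   T^d (type real^'d) and T^p x T^d (type (real^'p) \<times> (real^'d)) are treated uniformly. *)

definition torus_periodic :: "('a::euclidean_space \<Rightarrow> 'b) \<Rightarrow> bool" where
  "torus_periodic f \<longleftrightarrow> (\<forall>b\<in>Basis. \<forall>x. f (x + b) = f x)"

definition unit_cube :: "'a::euclidean_space set" where
  "unit_cube = {x. \<forall>b\<in>Basis. 0 \<le> x \<bullet> b \<and> x \<bullet> b < 1}"

definition torus :: "'a::euclidean_space measure" where
  "torus = uniform_measure lborel unit_cube"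

definition torus_prob_measure :: "'a::euclidean_space measure \<Rightarrow> bool" where
  "torus_prob_measure \<nu> \<longleftrightarrow>
     prob_space \<nu> \<and> sets \<nu> = sets borel \<and> (AE x in \<nu>. x \<in> unit_cube)"

primrec C_k :: "nat \<Rightarrow> ('a::euclidean_space \<Rightarrow> real) \<Rightarrow> bool" where
  "C_k 0 f \<longleftrightarrow> continuous_on UNIV f"
| "C_k (Suc k) f \<longleftrightarrow>
     (\<forall>x. f differentiable (at x)) \<and> (\<forall>v. C_k k (\<lambda>x. frechet_derivative f (at x) v))"

definition torus_smooth :: "('a::euclidean_space \<Rightarrow> real) \<Rightarrow> bool" where
  "torus_smooth f \<longleftrightarrow> torus_periodic f \<and> (\<forall>k. C_k k f)"

definition gradient :: "('a::euclidean_space \<Rightarrow> real) \<Rightarrow> 'a \<Rightarrow> 'a" where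
  "gradient f x = (THE D. GDERIV f x :> D)"

(* Elements of L^2 and H^1 are represented by Borel functions; all notions below are
   invariant under modification on null sets. *)

definition torus_L2 :: "('a::euclidean_space \<Rightarrow> 'b::euclidean_space) set" where
  "torus_L2 = {f. torus_periodic f \<and> f \<in> borel_measurable borel
                  \<and> integrable torus (\<lambda>x. (norm (f x))\<^sup>2)}"

definition has_weak_gradient ::
  "('a::euclidean_space \<Rightarrow> real) \<Rightarrow> ('a \<Rightarrow> 'a) \<Rightarrow> bool" where
  "has_weak_gradient f G \<longleftrightarrow> G \<in> torus_L2 \<and>
     (\<forall>\<phi>. torus_smooth \<phi> \<longrightarrow>
        (LINT x|torus. f x *\<^sub>R gradient \<phi> x) = - (LINT x|torus. \<phi> x *\<^sub>R G x))"

definition torus_H1 :: "('a::euclidean_space \<Rightarrow> real) set" where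
  "torus_H1 = {f \<in> torus_L2. \<exists>G. has_weak_gradient f G}"

(* The weak gradient is determined up to null sets; this picks a representative. *)
definition weak_gradient :: "('a::euclidean_space \<Rightarrow> real) \<Rightarrow> 'a \<Rightarrow> 'a" where
  "weak_gradient f = (SOME G. has_weak_gradient f G)"

definition H1_norm :: "('a::euclidean_space \<Rightarrow> real) \<Rightarrow> real" where
  "H1_norm f = sqrt ((LINT x|torus. (f x)\<^sup>2) + (LINT x|torus. (norm (weak_gradient f x))\<^sup>2))"

definition H_space :: "(real^'d::finite \<Rightarrow> real) set" where
  "H_space = {f \<in> torus_H1. (LINT z|torus. f z) = 0}"

definition J_functional ::
  "((real^'p::finite) \<times> (real^'d::finite) \<Rightarrow> real) \<Rightarrow> ((real^'d) \<times> (real^'d) \<Rightarrow> real) \<Rightarrow> real \<Rightarrow>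
   ((real^'p) \<times> (real^'d)) measure \<Rightarrow> (real^'d \<Rightarrow> real) \<Rightarrow> real" where
  "J_functional V K lam \<nu> f =
     (LINT ((q, y), z)|(\<nu> \<Otimes>\<^sub>M torus).
        (norm (gradient (\<lambda>y'. V (q, y')) y - weak_gradient f z))\<^sup>2 * K (y, z))
     + lam * (LINT z|torus. (norm (weak_gradient f z))\<^sup>2)"

definition Sigma_space :: "'d::finite \<Rightarrow> (real^'d \<Rightarrow> real) set" where
  "Sigma_space i = {g \<in> H_space. \<exists>r :: 'd \<Rightarrow> real \<Rightarrow> real.
       (\<forall>j. r j \<in> torus_H1) \<and> (LINT t|torus. r i t) = 0 \<and>
       (AE z in torus. g z = (\<Prod>j\<in>UNIV. r j (z $ j)))}"

(* The enumeration e lists the coordinates in the order 1,...,d in which they are cycled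
   through. *)
definition greedy_sequence ::
  "((real^'d::finite \<Rightarrow> real) \<Rightarrow> real) \<Rightarrow> (nat \<Rightarrow> 'd) \<Rightarrow> (nat \<Rightarrow> real^'d \<Rightarrow> real) \<Rightarrow> bool" where
  "greedy_sequence J e f \<longleftrightarrow>
     (\<forall>n. \<exists>g. is_arg_min (\<lambda>h. J (\<lambda>z. f n z + h z)) (\<lambda>h. h \<in> Sigma_space (e (n mod CARD('d)))) g
               \<and> f (Suc n) = (\<lambda>z. f n z + g z))"

end

theory Submission
  imports Defs
begin

text \<open>
  The functional is a quadratic polynomial: \<open>J f = c - 2 l f + a f f\<close>, where \<open>a\<close> is the bilinear form
  \<open>a f h = \<integral> w \<nabla>f \<bullet> \<nabla>h\<close> with the weight \<open>w z = \<integral> K (y, z) d\<nu> + lam\<close>. Since \<open>K\<close> is bounded and is either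
  bounded away from \<open>0\<close> or helped by \<open>lam > 0\<close>, \<open>a\<close> is equivalent to the square of the norm of the
  gradient, and by the Poincare inequality to the square of the \<open>H\<^sup>1\<close> norm on \<open>H\<close>. Completing the
  square at the minimizer \<open>f\<^sub>*\<close> gives \<open>J f = J f\<^sub>* + a (f - f\<^sub>*) (f - f\<^sub>*)\<close>. So for the error
  \<open>u\<^sub>n = f\<^sub>n - f\<^sub>*\<close> each step of the algorithm is a best approximation step of \<open>- u\<^sub>n\<close> by the cone
  \<open>\<Sigma>\<^sub>i\<close> in the semi-inner product \<open>a\<close>: a pure greedy algorithm that cycles through \<open>d\<close> dictionaries.

  The convergence (\<open>greedy_convergence\<close>) is the argument of Jones for greedy algorithms. Optimality gives
  \<open>\<parallel>u\<^sub>n\<^sub>+\<^sub>1\<parallel>\<^sup>2 = \<parallel>u\<^sub>n\<parallel>\<^sup>2 - \<parallel>g\<^sub>n\<parallel>\<^sup>2\<close>, so the increments are square summable, and \<open>\<bar>a u\<^sub>n h\<bar> \<le> \<parallel>g\<^sub>n\<parallel> \<parallel>h\<parallel>\<close> for \<open>h\<close> in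
  the dictionary of step \<open>n\<close>. For \<open>h\<close> in any of the dictionaries, waiting at most one cycle gives
  \<open>\<bar>a u\<^sub>n h\<bar> \<le> G\<^sub>n \<parallel>h\<parallel>\<close>, where \<open>G\<^sub>n\<close> is the sum of the next \<open>d\<close> increment norms. Hence
  \<open>\<bar>a (u\<^sub>m - u\<^sub>n) u\<^sub>m\<bar> \<le> G\<^sub>m (G\<^sub>0 + \<dots> + G\<^sub>m)\<close> for \<open>n \<le> m\<close>, which is small for suitable large \<open>m\<close> because \<open>G\<close> is square
  summable and the harmonic series diverges. Then \<open>u\<^sub>m\<close> is close to \<open>u\<^sub>n\<close>, which is close to a finite sum \<open>P\<close>
  of dictionary elements, and \<open>a u\<^sub>m P\<close> is small; so \<open>a u\<^sub>m u\<^sub>m\<close> is small. As the errors decrease in the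
  norm of \<open>a\<close>, they tend to \<open>0\<close>.

  What remains is that finite sums of elements of the \<open>\<Sigma>\<^sub>i\<close> are dense in \<open>H\<close> (\<open>Sigma_space_dense\<close>).
  The functions \<open>\<Prod>\<^sub>j cas (2 \<pi> \<kappa>\<^sub>j z\<^sub>j)\<close> with \<open>cas = cos + sin\<close> and \<open>\<kappa> \<in> \<int>\<^sup>d\<close> form a real orthonormal basis of
  \<open>L\<^sup>2\<close> of the torus that consists of tensor products, and those with \<open>\<kappa>\<^sub>i \<noteq> 0\<close> lie in \<open>\<Sigma>\<^sub>i\<close>. Differentiation
  permutes them up to factors, so partial sums commute with the weak gradient, and density
  in \<open>H\<close> reduces to the density of trigonometric polynomials in \<open>L\<^sup>2\<close> (\<open>trig_poly_dense_L2\<close>), that is to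
  the Stone-Weierstrass theorem.
\<close>

section \<open>Greedy approximation in a semi-inner product space\<close>

lemma quadratic_nonneg_imp_discriminant:
  fixes a b c :: real
  assumes "\<And>t. 0 \<le> a + 2 * t * b + t\<^sup>2 * c" "0 \<le> c"
  shows "b\<^sup>2 \<le> a * c"
proof (cases "c = 0")
  case True
  have "b = 0"
  proof (rule ccontr)
    assume "b \<noteq> 0"
    then have "a + 2 * (- (a + 1) / (2 * b)) * b = - 1" by (simp add: field_simps)
    with assms(1)[of "- (a + 1) / (2 * b)"] True show False by simp
  qed
  with True show ?thesis by simp
next
  case False
  then have "c > 0" using assms by simp
  have "0 \<le> c * (a + 2 * (- b / c) * b + (- b / c)\<^sup>2 * c)"
    using assms(2) by (rule mult_nonneg_nonneg[OF _ assms(1)])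
  also have "\<dots> = a * c - b\<^sup>2" using \<open>c > 0\<close> by (simp add: field_simps power2_eq_square)
  finally show ?thesis by simp
qed

text \<open>
  Otherwise \<open>x m \<ge> \<epsilon> / (x 0 + \<dots> + x m)\<close> for all large \<open>m\<close>; as the partial sums grow at most like \<open>sqrt m\<close> by
  Cauchy-Schwarz, \<open>(x m)\<^sup>2\<close> would dominate a multiple of the harmonic series.
\<close>

lemma square_summable_times_partial_sums:
  fixes x :: "nat \<Rightarrow> real"
  assumes nonneg: "\<And>k. 0 \<le> x k" and summ: "summable (\<lambda>k. (x k)\<^sup>2)" and "0 < \<epsilon>"
  obtains m where "m \<ge> M" "x m * (\<Sum>k\<le>m. x k) < \<epsilon>"
proof (rule ccontr)
  assume "\<not> thesis"
  with that have big: "\<epsilon> \<le> x m * (\<Sum>k\<le>m. x k)" if "m \<ge> M" for m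
    using \<open>m \<ge> M\<close> by (meson not_less)
  define C where "C = (\<Sum>k. (x k)\<^sup>2) + 1"
  have C: "C > 0" "(\<Sum>k\<le>m. (x k)\<^sup>2) \<le> C" for m
    using suminf_nonneg[OF summ] sum_le_suminf[OF summ, of "{..m}"] by (auto simp: C_def)
  have lower: "\<epsilon>\<^sup>2 / C * inverse (real (Suc m)) \<le> (x m)\<^sup>2" if m: "m \<ge> M" for m
  proof -
    have "\<epsilon>\<^sup>2 \<le> (x m * (\<Sum>k\<le>m. x k))\<^sup>2"
      using big[OF m] \<open>0 < \<epsilon>\<close> by (intro power_mono) auto
    also have "\<dots> = (x m)\<^sup>2 * (\<Sum>k\<le>m. 1 * x k)\<^sup>2" by (simp add: power_mult_distrib)
    also have "\<dots> \<le> (x m)\<^sup>2 * ((\<Sum>k\<le>m. 1\<^sup>2) * (\<Sum>k\<le>m. (x k)\<^sup>2))"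
      by (intro mult_left_mono Cauchy_Schwarz_ineq_sum) auto
    also have "\<dots> \<le> (x m)\<^sup>2 * (real (Suc m) * C)"
      using C by (intro mult_left_mono) auto
    finally have "\<epsilon>\<^sup>2 \<le> (x m)\<^sup>2 * (real (Suc m) * C)" .
    then show ?thesis using C(1) by (simp add: pos_divide_le_eq mult.assoc flip: divide_inverse divide_divide_eq_left)
  qed
  have "summable (\<lambda>m. \<epsilon>\<^sup>2 / C * inverse (real (Suc m)))"
  proof (rule summable_comparison_test[OF _ summ], intro exI allI impI)
    fix m assume "M \<le> m"
    then show "norm (\<epsilon>\<^sup>2 / C * inverse (real (Suc m))) \<le> (x m)\<^sup>2"
      using lower[of m] C by (simp add: abs_mult)
  qed
  then have "summable (\<lambda>m. inverse (real (Suc m)))"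
    using C \<open>0 < \<epsilon>\<close> by (subst (asm) summable_cmult_iff) auto
  then show False
    using not_summable_harmonic[where 'a=real] by (subst (asm) summable_Suc_iff[of "\<lambda>m. inverse (real m)"]) (simp add: field_simps)
qed

text \<open>
  Vectors are real functions with the pointwise operations, and \<open>ip\<close> may be degenerate: elements of
  \<open>L\<^sup>2\<close> and \<open>H\<^sup>1\<close> are functions here, not classes of functions that agree almost everywhere.
\<close>

locale semi_inner_product =
  fixes H :: "('s \<Rightarrow> real) set" and ip :: "('s \<Rightarrow> real) \<Rightarrow> ('s \<Rightarrow> real) \<Rightarrow> real"
  assumes zero_mem: "(\<lambda>x. 0) \<in> H"
    and add_mem: "f \<in> H \<Longrightarrow> g \<in> H \<Longrightarrow> (\<lambda>x. f x + g x) \<in> H"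
    and scale_mem: "f \<in> H \<Longrightarrow> (\<lambda>x. c * f x) \<in> H"
    and commute: "f \<in> H \<Longrightarrow> g \<in> H \<Longrightarrow> ip f g = ip g f"
    and add_left: "f \<in> H \<Longrightarrow> g \<in> H \<Longrightarrow> h \<in> H \<Longrightarrow> ip (\<lambda>x. f x + g x) h = ip f h + ip g h"
    and scale_left: "f \<in> H \<Longrightarrow> h \<in> H \<Longrightarrow> ip (\<lambda>x. c * f x) h = c * ip f h"
    and nonneg: "f \<in> H \<Longrightarrow> 0 \<le> ip f f"
begin

definition nrm :: "('s \<Rightarrow> real) \<Rightarrow> real" where "nrm f = sqrt (ip f f)"

lemma nrm_nonneg: "f \<in> H \<Longrightarrow> 0 \<le> nrm f"
  by (simp add: nrm_def nonneg)

lemma nrm_square: "f \<in> H \<Longrightarrow> (nrm f)\<^sup>2 = ip f f"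
  by (simp add: nrm_def nonneg)

lemma diff_mem: "f \<in> H \<Longrightarrow> g \<in> H \<Longrightarrow> (\<lambda>x. f x - g x) \<in> H"
  using add_mem[of f "\<lambda>x. (-1) * g x"] scale_mem[of g "-1"] by simp

lemma diff_left:
  assumes "f \<in> H" "g \<in> H" "h \<in> H"
  shows "ip (\<lambda>x. f x - g x) h = ip f h - ip g h"
  using add_left[of f "\<lambda>x. (-1) * g x" h] scale_mem[of g "-1"] scale_left[of g h "-1"] assms by simp

lemma add_right:
  "f \<in> H \<Longrightarrow> g \<in> H \<Longrightarrow> h \<in> H \<Longrightarrow> ip h (\<lambda>x. f x + g x) = ip h f + ip h g"
  using commute[of h "\<lambda>x. f x + g x"] commute[of h f] commute[of h g] by (simp add: add_left add_mem)

lemma diff_right: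
  "f \<in> H \<Longrightarrow> g \<in> H \<Longrightarrow> h \<in> H \<Longrightarrow> ip h (\<lambda>x. f x - g x) = ip h f - ip h g"
  using commute[of h "\<lambda>x. f x - g x"] commute[of h f] commute[of h g] by (simp add: diff_left diff_mem)

lemma scale_right: "f \<in> H \<Longrightarrow> h \<in> H \<Longrightarrow> ip h (\<lambda>x. c * f x) = c * ip h f"
  using commute[of h "\<lambda>x. c * f x"] commute[of h f] by (simp add: scale_left scale_mem)

lemma sum_mem: "(\<And>k. k \<in> I \<Longrightarrow> f k \<in> H) \<Longrightarrow> (\<lambda>x. \<Sum>k\<in>I. f k x) \<in> H"
  by (induction I rule: infinite_finite_induct) (simp_all add: zero_mem add_mem)

lemma zero_left: "h \<in> H \<Longrightarrow> ip (\<lambda>x. 0) h = 0"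
  using scale_left[of "\<lambda>x. 0" h 0] zero_mem by simp

lemma sum_left:
  "(\<And>k. k \<in> I \<Longrightarrow> f k \<in> H) \<Longrightarrow> h \<in> H \<Longrightarrow> ip (\<lambda>x. \<Sum>k\<in>I. f k x) h = (\<Sum>k\<in>I. ip (f k) h)"
  by (induction I rule: infinite_finite_induct) (simp_all add: zero_left add_left sum_mem)

lemma sum_right:
  assumes "\<And>k. k \<in> I \<Longrightarrow> f k \<in> H" "h \<in> H"
  shows "ip h (\<lambda>x. \<Sum>k\<in>I. f k x) = (\<Sum>k\<in>I. ip h (f k))"
proof -
  have "ip h (\<lambda>x. \<Sum>k\<in>I. f k x) = (\<Sum>k\<in>I. ip (f k) h)"
    using sum_left[of I f h] commute[OF assms(2) sum_mem[of I f]] assms by simp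
  also have "\<dots> = (\<Sum>k\<in>I. ip h (f k))" using assms by (intro sum.cong refl commute)
  finally show ?thesis .
qed

lemma square_add:
  "f \<in> H \<Longrightarrow> g \<in> H \<Longrightarrow> ip (\<lambda>x. f x + g x) (\<lambda>x. f x + g x) = ip f f + 2 * ip f g + ip g g"
  using commute[of g f] by (simp add: add_left add_right add_mem)

lemma square_diff:
  "f \<in> H \<Longrightarrow> g \<in> H \<Longrightarrow> ip (\<lambda>x. f x - g x) (\<lambda>x. f x - g x) = ip f f - 2 * ip f g + ip g g"
  using commute[of g f] by (simp add: diff_left diff_right diff_mem)

lemma square_add_scale:
  "f \<in> H \<Longrightarrow> g \<in> H \<Longrightarrow>
    ip (\<lambda>x. f x + t * g x) (\<lambda>x. f x + t * g x) = ip f f + 2 * t * ip f g + t\<^sup>2 * ip g g"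
  using square_add[of f "\<lambda>x. t * g x"] by (simp add: scale_mem scale_left scale_right power2_eq_square)

lemma Cauchy_Schwarz:
  assumes "f \<in> H" "g \<in> H"
  shows "\<bar>ip f g\<bar> \<le> nrm f * nrm g"
proof -
  have "(ip f g)\<^sup>2 \<le> ip f f * ip g g"
  proof (rule quadratic_nonneg_imp_discriminant)
    show "0 \<le> ip f f + 2 * t * ip f g + t\<^sup>2 * ip g g" for t
      using nonneg[OF add_mem[OF assms(1) scale_mem[OF assms(2), of t]]] square_add_scale[OF assms] by simp
  qed (rule nonneg[OF assms(2)])
  then have "sqrt ((ip f g)\<^sup>2) \<le> sqrt (ip f f * ip g g)" by (rule real_sqrt_le_mono)
  then show ?thesis unfolding nrm_def real_sqrt_mult by simp
qed

text \<open>
  Pythagoras for an orthonormal family: the choice of coefficients \<open>c k = ip f (\<Phi> k)\<close> is optimal, and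
  it gives the Bessel inequality.
\<close>

lemma dist_linear_combination:
  assumes "finite I" and \<Phi>: "\<And>k. k \<in> I \<Longrightarrow> \<Phi> k \<in> H"
    and on: "\<And>k l. k \<in> I \<Longrightarrow> l \<in> I \<Longrightarrow> ip (\<Phi> k) (\<Phi> l) = (if k = l then 1 else 0)"
    and f: "f \<in> H"
  shows "ip (\<lambda>x. f x - (\<Sum>k\<in>I. c k * \<Phi> k x)) (\<lambda>x. f x - (\<Sum>k\<in>I. c k * \<Phi> k x))
    = ip f f - (\<Sum>k\<in>I. (ip f (\<Phi> k))\<^sup>2) + (\<Sum>k\<in>I. (c k - ip f (\<Phi> k))\<^sup>2)"
proof -
  have c\<Phi>: "(\<lambda>x. c k * \<Phi> k x) \<in> H" if "k \<in> I" for k using \<Phi> that by (intro scale_mem)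
  let ?S = "\<lambda>x. \<Sum>k\<in>I. c k * \<Phi> k x"
  have S: "?S \<in> H" using sum_mem[of I "\<lambda>k x. c k * \<Phi> k x"] c\<Phi> by simp
  have 1: "ip f ?S = (\<Sum>k\<in>I. c k * ip f (\<Phi> k))"
    using sum_right[of I "\<lambda>k x. c k * \<Phi> k x" f] c\<Phi> f by (simp add: scale_right \<Phi>)
  have "ip (\<Phi> l) ?S = c l" if l: "l \<in> I" for l
    using sum_right[of I "\<lambda>k x. c k * \<Phi> k x" "\<Phi> l"] c\<Phi> \<Phi> l
    by (simp add: scale_right on if_distrib \<open>finite I\<close> sum.delta' cong: if_cong)
  then have 2: "ip ?S ?S = (\<Sum>k\<in>I. c k * c k)"
    using sum_left[of I "\<lambda>k x. c k * \<Phi> k x" ?S] c\<Phi> \<Phi> S by (simp add: scale_left)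
  show ?thesis
    unfolding square_diff[OF f S] 1 2
    by (simp add: power2_diff sum.distrib sum_subtractf sum_distrib_left power2_eq_square algebra_simps)
qed

text \<open>
  The dictionaries \<open>D i\<close> are cones, not subspaces, and step \<open>n\<close> uses only the dictionary of index \<open>n mod d\<close>.
  The residual of step \<open>n\<close> is controlled on the dictionary of that step; the proof transfers this to all
  dictionaries at the price of replacing one increment by the sum \<open>G n\<close> of \<open>d\<close> successive ones.
  The index type \<open>'k\<close> of the approximating sums is left free for the application.
\<close>

theorem greedy_convergence:
  fixes D :: "'i \<Rightarrow> ('s \<Rightarrow> real) set" and e :: "nat \<Rightarrow> 'i"
    and u g :: "nat \<Rightarrow> 's \<Rightarrow> real"
  assumes d: "0 < d" and cover: "\<And>i. \<exists>k<d. e k = i"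
    and DH: "\<And>i. D i \<subseteq> H"
    and D_scale: "\<And>i h c. h \<in> D i \<Longrightarrow> (\<lambda>x. c * h x) \<in> D i"
    and total: "\<And>v \<epsilon>. v \<in> H \<Longrightarrow> 0 < \<epsilon> \<Longrightarrow> \<exists>(I::'k set) h. finite I \<and> (\<forall>k\<in>I. h k \<in> (\<Union>i. D i)) \<and>
        nrm (\<lambda>x. v x - (\<Sum>k\<in>I. h k x)) < \<epsilon>"
    and u0: "u 0 \<in> H"
    and gD: "\<And>n. g n \<in> D (e (n mod d))"
    and step: "\<And>n. u (Suc n) = (\<lambda>x. u n x + g n x)"
    and best: "\<And>n h. h \<in> D (e (n mod d)) \<Longrightarrow>
        ip (u (Suc n)) (u (Suc n)) \<le> ip (\<lambda>x. u n x + h x) (\<lambda>x. u n x + h x)"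
  shows "(\<lambda>n. ip (u n) (u n)) \<longlonglongrightarrow> 0"
proof -
  have gH: "g n \<in> H" for n using gD DH by blast
  have uH: "u n \<in> H" for n by (induction n) (auto simp: u0 step add_mem gH)
  define N where "N n = ip (u n) (u n)" for n
  define x where "x n = nrm (g n)" for n
  have x0: "0 \<le> x n" and xsq: "(x n)\<^sup>2 = ip (g n) (g n)" for n
    by (simp_all add: x_def nrm_nonneg nrm_square gH)
  have N0: "0 \<le> N n" for n by (simp add: N_def nonneg uH)
  have ineq: "N (Suc n) \<le> N n + 2 * t * ip (u n) h + t\<^sup>2 * ip h h" if "h \<in> D (e (n mod d))" for n h t
    using best[OF D_scale[OF that, of t]] square_add_scale[OF uH, of h n t] that subsetD[OF DH that]
    by (simp add: N_def del: step)
  have eq: "N (Suc n) = N n + 2 * ip (u n) (g n) + ip (g n) (g n)" for n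
    unfolding N_def step by (rule square_add[OF uH gH])
  \<comment> \<open>First-order optimality of the factor 1 among all multiples of the increment.\<close>
  have ortho: "ip (u n) (g n) = - ip (g n) (g n)" for n
  proof -
    let ?a = "ip (u n) (g n)" and ?b = "ip (g n) (g n)"
    have "0 \<le> 0 + 2 * s * (?a + ?b) + s\<^sup>2 * ?b" for s
      using ineq[OF gD[of n], of "1 + s"] eq[of n] by (simp add: algebra_simps power2_eq_square)
    from quadratic_nonneg_imp_discriminant[OF this] have "(?a + ?b)\<^sup>2 \<le> 0"
      by (simp add: nonneg gH)
    then show ?thesis by simp
  qed
  have NSuc: "N (Suc n) = N n - (x n)\<^sup>2" for n using eq[of n] ortho[of n] xsq[of n] by linarith
  have dual: "\<bar>ip (u n) h\<bar> \<le> x n * nrm h" if h: "h \<in> D (e (n mod d))" for n h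
  proof -
    have hH: "h \<in> H" using h DH by blast
    have "(ip (u n) h)\<^sup>2 \<le> (x n)\<^sup>2 * ip h h"
      by (rule quadratic_nonneg_imp_discriminant) (use ineq[OF h] NSuc[of n] nonneg[OF hH] in \<open>auto simp: algebra_simps\<close>)
    then have "sqrt ((ip (u n) h)\<^sup>2) \<le> sqrt ((x n)\<^sup>2 * ip h h)" by (rule real_sqrt_le_mono)
    then show ?thesis by (simp add: real_sqrt_mult nrm_def x0)
  qed
  have Ndec: "decseq N" by (rule decseq_SucI) (simp add: NSuc)
  have sumx: "(\<Sum>k<n. (x k)\<^sup>2) = N 0 - N n" for n by (induction n) (auto simp: NSuc)
  have summx: "summable (\<lambda>k. (x k)\<^sup>2)"
    by (rule bounded_imp_summable[of _ "N 0"]) (auto simp: sumx N0 lessThan_Suc_atMost[symmetric])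
  define G where "G m = (\<Sum>l<d. x (m + l))" for m
  have xG: "x m \<le> G m" for m
    using member_le_sum[of 0 "{..<d}" "\<lambda>l. x (m + l)"] d x0 by (auto simp: G_def)
  have G0: "0 \<le> G m" for m by (simp add: G_def sum_nonneg x0)
  have summG: "summable (\<lambda>m. (G m)\<^sup>2)"
  proof (rule summable_comparison_test)
    show "\<exists>N. \<forall>n\<ge>N. norm ((G n)\<^sup>2) \<le> real d * (\<Sum>l<d. (x (n + l))\<^sup>2)"
      using Cauchy_Schwarz_ineq_sum[of "\<lambda>_. 1" _ "{..<d}"] by (auto simp: G_def)
    show "summable (\<lambda>n. real d * (\<Sum>l<d. (x (n + l))\<^sup>2))"
      by (intro summable_mult summable_sum summable_ignore_initial_segment[OF summx])
  qed
  have Glim: "G \<longlonglongrightarrow> 0"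
    using tendsto_real_sqrt[OF summable_LIMSEQ_zero[OF summG]] G0 by simp
  have udiff: "ip (u (m + k)) h = ip (u m) h + (\<Sum>l<k. ip (g (m + l)) h)" if "h \<in> H" for m k h
  proof (induction k)
    case (Suc k)
    have "ip (u (m + Suc k)) h = ip (u (m + k)) h + ip (g (m + k)) h"
      unfolding add_Suc_right step by (rule add_left[OF uH gH that])
    with Suc show ?case by simp
  qed simp
  \<comment> \<open>Within one cycle after step m the dictionary containing h is used, and until then
    the residual moves by at most the sum of the increments.\<close>
  have dualG: "\<bar>ip (u m) h\<bar> \<le> G m * nrm h" if h: "h \<in> (\<Union>i. D i)" for m h
  proof -
    obtain i where i: "h \<in> D i" using h by blast
    then have hH: "h \<in> H" using DH by blast
    obtain k0 where k0: "k0 < d" "e k0 = i" using cover by blast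
    \<comment> \<open>The number of steps from m until the dictionary of index k0 is due.\<close>
    define k where "k = (k0 + d - m mod d) mod d"
    have k: "k < d" using d by (simp add: k_def)
    have "(m + k) mod d = (m mod d + (k0 + d - m mod d)) mod d"
      by (simp only: k_def mod_add_left_eq mod_add_right_eq)
    also have "m mod d + (k0 + d - m mod d) = k0 + d"
      using mod_less_divisor[OF d, of m] by linarith
    finally have "(m + k) mod d = k0" using k0 by simp
    then have "\<bar>ip (u (m + k)) h\<bar> \<le> x (m + k) * nrm h" using dual[of h "m + k"] i k0 by simp
    moreover have "\<bar>\<Sum>l<k. ip (g (m + l)) h\<bar> \<le> (\<Sum>l<k. x (m + l) * nrm h)"
      by (rule order_trans[OF sum_abs sum_mono]) (simp add: x_def Cauchy_Schwarz gH hH)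
    ultimately have "\<bar>ip (u m) h\<bar> \<le> (\<Sum>l<Suc k. x (m + l) * nrm h)"
      using udiff[OF hH, of m k] by simp
    also have "\<dots> = (\<Sum>l<Suc k. x (m + l)) * nrm h" by (simp only: sum_distrib_right)
    also have "\<dots> \<le> G m * nrm h"
      unfolding G_def using k x0 nrm_nonneg[OF hH] by (intro mult_right_mono sum_mono2) auto
    finally show ?thesis .
  qed
  \<comment> \<open>The decreasing sequence N has a limit L; it remains to find indices at which N is small.\<close>
  obtain L where L: "N \<longlonglongrightarrow> L" "\<And>n. L \<le> N n"
    using decseq_convergent[OF Ndec, of 0] N0 by metis
  have "L \<le> 0"
  proof (rule field_le_epsilon)
    fix \<eta> :: real assume "0 < \<eta>"
    define A where "A = sqrt (N 0) + 1"
    have A: "A \<ge> 1" by (simp add: A_def N0)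
    define \<delta> where "\<delta> = \<eta> / (4 * A)"
    have \<delta>: "0 < \<delta>" using \<open>0 < \<eta>\<close> A by (simp add: \<delta>_def)
    have nA: "nrm (u m) \<le> A" for m
      using real_sqrt_le_mono[OF decseqD[OF Ndec, of 0 m]] unfolding A_def nrm_def N_def by linarith
    have "eventually (\<lambda>n. N n < L + \<delta>\<^sup>2 / 2) sequentially"
      using L(1) \<delta> by (intro order_tendstoD) auto
    then obtain n where n: "N n < L + \<delta>\<^sup>2 / 2" by (auto simp: eventually_sequentially)
    obtain I :: "'k set" and h where I: "finite I" "\<forall>k\<in>I. h k \<in> (\<Union>i. D i)"
        "nrm (\<lambda>x. u n x - (\<Sum>k\<in>I. h k x)) < \<delta>"
      using total[OF uH \<delta>] by blast
    let ?P = "\<lambda>x. \<Sum>k\<in>I. h k x"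
    have hH: "h k \<in> H" if "k \<in> I" for k using I(2) DH that by blast
    have PH: "?P \<in> H" using sum_mem[of I h] hH by simp
    have Pbound: "\<bar>ip (u m) ?P\<bar> \<le> G m * (\<Sum>k\<in>I. nrm (h k))" for m
    proof -
      have "\<bar>ip (u m) ?P\<bar> \<le> (\<Sum>k\<in>I. \<bar>ip (u m) (h k)\<bar>)"
        using sum_right[of I h "u m"] hH uH by (simp add: sum_abs)
      also have "\<dots> \<le> (\<Sum>k\<in>I. G m * nrm (h k))" using dualG I(2) by (intro sum_mono) auto
      finally show ?thesis by (simp add: sum_distrib_left)
    qed
    have "(\<lambda>m. G m * (\<Sum>k\<in>I. nrm (h k))) \<longlonglongrightarrow> 0" using tendsto_mult_left_zero[OF Glim] by simp
    then have "eventually (\<lambda>m. G m * (\<Sum>k\<in>I. nrm (h k)) < \<eta> / 4) sequentially"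
      using \<open>0 < \<eta>\<close> by (intro order_tendstoD) auto
    then obtain m0 where m0: "\<And>m. m \<ge> m0 \<Longrightarrow> G m * (\<Sum>k\<in>I. nrm (h k)) < \<eta> / 4"
      by (auto simp: eventually_sequentially)
    obtain m where m: "m \<ge> max n m0" "G m * (\<Sum>k\<le>m. G k) < \<delta>\<^sup>2 / 4"
      using square_summable_times_partial_sums[OF G0 summG, of "\<delta>\<^sup>2 / 4" "max n m0"] \<delta> by auto
    have gdual: "\<bar>ip (g k) (u m)\<bar> \<le> G m * x k" for k
      using dualG[of "g k" m] gD[of k] commute[OF uH gH, of m k] by (auto simp: x_def)
    have diffs: "\<bar>ip (u m) (u m) - ip (u n) (u m)\<bar> \<le> \<delta>\<^sup>2 / 4"
    proof -
      have "ip (u m) (u m) - ip (u n) (u m) = (\<Sum>l<m - n. ip (g (n + l)) (u m))"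
        using udiff[OF uH, of n "m - n" m] m by simp
      also have "\<bar>\<dots>\<bar> \<le> (\<Sum>l<m - n. G m * x (n + l))"
        by (intro order_trans[OF sum_abs sum_mono] gdual)
      also have "\<dots> = G m * (\<Sum>k\<in>{n..<m}. x k)"
        unfolding sum_distrib_left
        by (rule sum.reindex_bij_witness[of _ "\<lambda>k. k - n" "\<lambda>l. n + l"]) auto
      also have "\<dots> \<le> G m * (\<Sum>k\<le>m. G k)"
        using G0 xG by (intro mult_left_mono order_trans[OF sum_mono sum_mono2]) auto
      finally show ?thesis using m by simp
    qed
    have "(nrm (\<lambda>x. u m x - u n x))\<^sup>2 = N m - 2 * ip (u n) (u m) + N n"
      using square_diff[OF uH uH, of m n] by (simp add: nrm_square diff_mem uH N_def commute)
    also have "\<dots> \<le> \<delta>\<^sup>2" using abs_le_D1[OF diffs] n L(2)[of m] unfolding N_def by linarith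
    finally have close: "nrm (\<lambda>x. u m x - u n x) \<le> \<delta>" by (rule power2_le_imp_le) (use \<delta> in simp)
    have "N m = ip (u m) (\<lambda>x. u m x - u n x) + ip (u m) (\<lambda>x. u n x - ?P x) + ip (u m) ?P"
      by (simp add: diff_right uH PH N_def)
    also have "\<dots> \<le> A * \<delta> + A * \<delta> + \<eta> / 4"
    proof (intro add_mono)
      have "ip (u m) (\<lambda>x. u m x - u n x) \<le> nrm (u m) * nrm (\<lambda>x. u m x - u n x)"
        by (rule order_trans[OF abs_ge_self Cauchy_Schwarz[OF uH diff_mem[OF uH uH]]])
      also have "\<dots> \<le> A * \<delta>" using nA close nrm_nonneg uH diff_mem A by (intro mult_mono) auto
      finally show "ip (u m) (\<lambda>x. u m x - u n x) \<le> A * \<delta>" .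
      have "ip (u m) (\<lambda>x. u n x - ?P x) \<le> nrm (u m) * nrm (\<lambda>x. u n x - ?P x)"
        by (rule order_trans[OF abs_ge_self Cauchy_Schwarz[OF uH diff_mem[OF uH PH]]])
      also have "\<dots> \<le> A * \<delta>" using nA I(3) nrm_nonneg uH diff_mem PH A by (intro mult_mono) auto
      finally show "ip (u m) (\<lambda>x. u n x - ?P x) \<le> A * \<delta>" .
      show "ip (u m) ?P \<le> \<eta> / 4"
        using abs_le_D1[OF Pbound[of m]] m0[of m] m by simp
    qed
    also have "\<dots> \<le> \<eta>" using A \<open>0 < \<eta>\<close> by (simp add: \<delta>_def)
    finally show "L \<le> 0 + \<eta>" using L(2)[of m] by simp
  qed
  moreover have "0 \<le> L" using LIMSEQ_le_const[OF L(1)] N0 by blast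
  ultimately show ?thesis using L(1) by (simp add: N_def[abs_def])
qed

text \<open>
  Completing the square. The first-order condition at the minimizer makes the cross term vanish.
\<close>

lemma quadratic_minimizer:
  assumes J: "\<And>f. f \<in> H \<Longrightarrow> J f = c - 2 * l f + ip f f"
    and l_add: "\<And>f g t. f \<in> H \<Longrightarrow> g \<in> H \<Longrightarrow> l (\<lambda>x. f x + t * g x) = l f + t * l g"
    and min: "is_arg_min J (\<lambda>f. f \<in> H) fs" and f: "f \<in> H"
  shows "J f = J fs + ip (\<lambda>x. f x - fs x) (\<lambda>x. f x - fs x)"
proof -
  have fs: "fs \<in> H" and le: "\<And>h. h \<in> H \<Longrightarrow> J fs \<le> J h"
    using min by (auto simp: is_arg_min_def not_less)
  let ?h = "\<lambda>x. f x - fs x"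
  have h: "?h \<in> H" by (rule diff_mem[OF f fs])
  have expand: "J (\<lambda>x. fs x + t * ?h x) = J fs + 2 * t * (ip fs ?h - l ?h) + t\<^sup>2 * ip ?h ?h" for t
  proof -
    let ?k = "\<lambda>x. fs x + t * ?h x"
    have "?k \<in> H" by (rule add_mem[OF fs scale_mem[OF h]])
    then have "J ?k = c - 2 * l ?k + ip ?k ?k" by (rule J)
    also have "\<dots> = c - 2 * (l fs + t * l ?h) + (ip fs fs + 2 * t * ip fs ?h + t\<^sup>2 * ip ?h ?h)"
      by (simp only: square_add_scale[OF fs h] l_add[OF fs h])
    finally show ?thesis by (simp add: J[OF fs] algebra_simps)
  qed
  have "0 \<le> 0 + 2 * t * (ip fs ?h - l ?h) + t\<^sup>2 * ip ?h ?h" for t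
    using le[OF add_mem[OF fs scale_mem[OF h]], of t] unfolding expand by simp
  from quadratic_nonneg_imp_discriminant[OF this nonneg[OF h]] have "ip fs ?h - l ?h = 0" by simp
  then show ?thesis using expand[of 1] by simp
qed

end

section \<open>Calculus on the torus\<close>

lemma inner_square_integrable:
  fixes f g :: "'x \<Rightarrow> 'b::euclidean_space"
  assumes [measurable]: "f \<in> borel_measurable M" "g \<in> borel_measurable M"
    and "integrable M (\<lambda>x. (norm (f x))\<^sup>2)" "integrable M (\<lambda>x. (norm (g x))\<^sup>2)"
  shows "integrable M (\<lambda>x. f x \<bullet> g x)"
proof (rule Bochner_Integration.integrable_bound)
  show "integrable M (\<lambda>x. (norm (f x))\<^sup>2 + (norm (g x))\<^sup>2)" using assms by auto
  show "AE x in M. norm (f x \<bullet> g x) \<le> norm ((norm (f x))\<^sup>2 + (norm (g x))\<^sup>2)"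
  proof (rule AE_I2)
    fix x
    have "\<bar>f x \<bullet> g x\<bar> \<le> norm (f x) * norm (g x)" by (rule Cauchy_Schwarz_ineq2)
    also have "\<dots> \<le> (norm (f x))\<^sup>2 + (norm (g x))\<^sup>2"
      using sum_squares_bound[of "norm (f x)" "norm (g x)"] mult_nonneg_nonneg[OF norm_ge_zero norm_ge_zero, of "f x" "g x"]
      by linarith
    finally show "norm (f x \<bullet> g x) \<le> norm ((norm (f x))\<^sup>2 + (norm (g x))\<^sup>2)" by simp
  qed
qed measurable

lemma add_square_integrable:
  fixes f g :: "'x \<Rightarrow> 'b::euclidean_space"
  assumes [measurable]: "f \<in> borel_measurable M" "g \<in> borel_measurable M"
    and "integrable M (\<lambda>x. (norm (f x))\<^sup>2)" "integrable M (\<lambda>x. (norm (g x))\<^sup>2)"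
  shows "integrable M (\<lambda>x. (norm (f x + g x))\<^sup>2)"
proof -
  have "integrable M (\<lambda>x. (norm (f x))\<^sup>2 + 2 * (f x \<bullet> g x) + (norm (g x))\<^sup>2)"
    using assms inner_square_integrable[OF assms] by auto
  then show ?thesis
    by (rule back_subst[of "integrable M"])
      (simp add: fun_eq_iff power2_norm_eq_inner inner_add_left inner_add_right inner_commute)
qed

lemma unit_cube_borel [measurable]: "unit_cube \<in> sets (borel :: 'a::euclidean_space measure)"
  unfolding unit_cube_def by measurable

lemma emeasure_unit_cube: "emeasure lborel (unit_cube :: 'a::euclidean_space set) = 1"
proof (rule antisym)
  have "unit_cube \<subseteq> cbox 0 (One :: 'a)" by (auto simp: unit_cube_def cbox_def less_imp_le)
  from emeasure_mono[OF this, of lborel]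
  show "emeasure lborel (unit_cube :: 'a set) \<le> 1"
    by (simp add: emeasure_lborel_cbox)
  have "box 0 (One :: 'a) \<subseteq> unit_cube" by (auto simp: unit_cube_def box_def less_imp_le)
  from emeasure_mono[OF this, of lborel]
  show "1 \<le> emeasure lborel (unit_cube :: 'a set)"
    by (simp add: emeasure_lborel_box)
qed

lemma sets_torus [simp, measurable_cong]: "sets torus = sets borel"
  by (simp add: torus_def)

lemma measurable_torus [simp]: "measurable torus N = measurable borel N"
  by (rule measurable_cong_sets) simp_all

lemma space_torus [simp]: "space torus = UNIV"
  by (simp add: torus_def)

lemma torus_eq_density: "(torus :: 'a::euclidean_space measure) = density lborel (\<lambda>x. ennreal (indicator unit_cube x))"
  by (simp add: torus_def uniform_measure_def emeasure_unit_cube ennreal_indicator divide_ennreal_def)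

lemma prob_space_torus: "prob_space (torus :: 'a::euclidean_space measure)"
  unfolding torus_def by (rule prob_space_uniform_measure) (simp_all add: emeasure_unit_cube)

interpretation torus: prob_space "torus :: 'a::euclidean_space measure"
  by (rule prob_space_torus)

lemma torus_AE_unit_cube: "AE x in torus. x \<in> unit_cube"
  unfolding torus_def by (rule AE_uniform_measureI) auto

lemma torus_integral_eq:
  fixes f :: "'a::euclidean_space \<Rightarrow> real"
  assumes [measurable]: "f \<in> borel_measurable borel"
  shows "(LINT x|torus. f x) = (LINT x|lborel. indicator unit_cube x * f x)"
  unfolding torus_eq_density by (subst integral_density) auto

lemma torus_periodic_int:
  assumes "torus_periodic f" "b \<in> Basis"
  shows "f (x + of_int n *\<^sub>R b) = f x"
proof -
  have nat: "f (y + of_nat k *\<^sub>R b) = f y" for k :: nat and y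
  proof (induction k)
    case (Suc k)
    have "f (y + of_nat (Suc k) *\<^sub>R b) = f ((y + of_nat k *\<^sub>R b) + b)"
      by (simp add: scaleR_add_left add.commute add.left_commute)
    also have "\<dots> = f (y + of_nat k *\<^sub>R b)" using assms unfolding torus_periodic_def by blast
    finally show ?case using Suc by simp
  qed simp
  show ?thesis
  proof (cases "n \<ge> 0")
    case True then show ?thesis using nat[of x "nat n"] by simp
  next
    case False then show ?thesis using nat[of "x + of_int n *\<^sub>R b" "nat (- n)"] by simp
  qed
qed

text \<open>
  Reduction to the compact cube, through which compactness arguments apply to periodic functions.
\<close>

lemma torus_periodic_representative:
  fixes x :: "'a::euclidean_space"
  assumes f: "torus_periodic f"
  obtains y where "y \<in> cbox 0 One" "f x = f y"
proof -
  have shift: "finite B \<Longrightarrow> B \<subseteq> Basis \<Longrightarrow> f (y + (\<Sum>b\<in>B. of_int (n b) *\<^sub>R b)) = f y" for B n y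
  proof (induction B arbitrary: y rule: finite_induct)
    case (insert b B)
    then have "f (y + (\<Sum>b\<in>insert b B. of_int (n b) *\<^sub>R b))
      = f ((y + of_int (n b) *\<^sub>R b) + (\<Sum>b\<in>B. of_int (n b) *\<^sub>R b))" by (simp add: add.assoc)
    also have "\<dots> = f (y + of_int (n b) *\<^sub>R b)" using insert by simp
    also have "\<dots> = f y" using insert f by (intro torus_periodic_int) auto
    finally show ?case .
  qed simp
  define y where "y = (\<Sum>b\<in>Basis. frac (x \<bullet> b) *\<^sub>R b)"
  have "y + (\<Sum>b\<in>Basis. of_int \<lfloor>x \<bullet> b\<rfloor> *\<^sub>R b) = (\<Sum>b\<in>Basis. (x \<bullet> b) *\<^sub>R b)"
    unfolding y_def by (simp add: sum.distrib[symmetric] frac_def flip: scaleR_add_left)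
  then have "y + (\<Sum>b\<in>Basis. of_int \<lfloor>x \<bullet> b\<rfloor> *\<^sub>R b) = x"
    by (simp add: euclidean_representation)
  then have "f x = f y" using shift[of Basis y "\<lambda>b. \<lfloor>x \<bullet> b\<rfloor>"] by simp
  moreover have "y \<in> cbox 0 One" by (simp add: y_def cbox_def frac_lt_1 less_imp_le)
  ultimately show ?thesis using that by blast
qed

lemma torus_periodic_continuous_bounded:
  fixes f :: "'a::euclidean_space \<Rightarrow> 'b::real_normed_vector"
  assumes "torus_periodic f" "continuous_on UNIV f"
  obtains B where "0 \<le> B" "\<And>x. norm (f x) \<le> B"
proof -
  have "compact (f ` cbox 0 One)"
    by (intro compact_continuous_image compact_cbox continuous_on_subset[OF assms(2)]) auto
  then obtain B where B: "\<And>y. y \<in> cbox 0 One \<Longrightarrow> norm (f y) \<le> B"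
    by (meson bounded_iff compact_imp_bounded imageI)
  have *: "norm (f x) \<le> B" for x
    using torus_periodic_representative[OF assms(1), of x] B by metis
  then have "0 \<le> B" using norm_ge_zero order_trans by blast
  with * that show ?thesis by blast
qed

lemma torus_periodic_continuous_integrable:
  fixes f :: "'a::euclidean_space \<Rightarrow> 'b::euclidean_space"
  assumes "torus_periodic f" "continuous_on UNIV f"
  shows "integrable torus f"
proof -
  obtain B where "\<And>x. norm (f x) \<le> B" using torus_periodic_continuous_bounded[OF assms] by blast
  then show ?thesis
    by (intro torus.integrable_const_bound[of _ B] AE_I2)
      (use borel_measurable_continuous_onI[OF assms(2)] in auto)
qed

lemma torus_periodic_continuous_L2:
  fixes f :: "'a::euclidean_space \<Rightarrow> 'b::euclidean_space"
  assumes "torus_periodic f" "continuous_on UNIV f"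
  shows "f \<in> torus_L2"
proof -
  have "integrable torus (\<lambda>x. (norm (f x))\<^sup>2)"
    by (intro torus_periodic_continuous_integrable continuous_intros assms)
      (use assms(1) in \<open>simp add: torus_periodic_def\<close>)
  then show ?thesis
    using assms borel_measurable_continuous_onI[OF assms(2)] by (simp add: torus_L2_def)
qed

lemma torus_integral_translate:
  fixes f :: "'a::euclidean_space \<Rightarrow> real"
  assumes per: "torus_periodic f" and cont: "continuous_on UNIV f"
    and b: "b \<in> Basis" and t: "0 \<le> t" "t \<le> 1"
  shows "(LINT x|torus. f (x + t *\<^sub>R b)) = (LINT x|torus. f x)"
proof -
  have [measurable]: "f \<in> borel_measurable borel" using borel_measurable_continuous_onI[OF cont] .
  obtain B where B: "\<And>x. norm (f x) \<le> B" using torus_periodic_continuous_bounded[OF per cont] by blast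
  let ?C = "unit_cube :: 'a set"
  define C1 where "C1 = {x \<in> ?C. t \<le> x \<bullet> b}"
  define C2 where "C2 = {x \<in> ?C. x \<bullet> b < t}"
  have [measurable]: "C1 \<in> sets borel" "C2 \<in> sets borel"
    unfolding C1_def C2_def by measurable
  have int_C: "integrable lborel (indicator ?C :: 'a \<Rightarrow> real)"
    by (rule integrable_real_indicator) (auto simp: emeasure_unit_cube)
  have int: "integrable lborel (\<lambda>x. indicator A x * f x)" if "A \<subseteq> ?C" "A \<in> sets borel" for A
  proof (rule Bochner_Integration.integrable_bound[OF integrable_mult_left[OF int_C, of B]])
    show "(\<lambda>x. indicator A x * f x) \<in> borel_measurable lborel" using that by measurable
    show "AE x in lborel. norm (indicator A x * f x) \<le> norm (indicator ?C x * B)"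
      using that B by (auto intro!: AE_I2 order_trans[OF _ abs_ge_self] split: split_indicator)
  qed
  have shift_int: "(LINT x|lborel. g (x + v)) = (LINT x|lborel. g x)"
    if [measurable]: "g \<in> borel_measurable borel" for g :: "'a \<Rightarrow> real" and v
    by (subst (2) lborel_distr_plus[of v, symmetric], subst integral_distr) (auto simp: add.commute)
  have shift_int2: "integrable lborel (\<lambda>x. g (x + v))"
    if "integrable lborel g" for g :: "'a \<Rightarrow> real" and v
  proof -
    have [measurable]: "g \<in> borel_measurable borel" using borel_measurable_integrable[OF that] by simp
    have "integrable (distr lborel borel ((+) v)) g" using that by (simp only: lborel_distr_plus)
    then show ?thesis by (subst (asm) integrable_distr_eq) (auto simp: add.commute)
  qed
  have bb: "b \<bullet> b = 1" "\<And>b'. b' \<in> Basis \<Longrightarrow> b' \<noteq> b \<Longrightarrow> b \<bullet> b' = 0"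
    using b by (auto simp: inner_not_same_Basis)
  \<comment> \<open>The translated cube is cut along a hyperplane, and the part that sticks out is moved back by one period.\<close>
  have split: "(indicator ?C (x - t *\<^sub>R b) :: real) = indicator C1 x + indicator C2 (x - b)" for x
  proof -
    have mem: "y - s *\<^sub>R b \<in> ?C \<longleftrightarrow> (0 \<le> y \<bullet> b - s \<and> y \<bullet> b - s < 1) \<and> (\<forall>b'\<in>Basis - {b}. 0 \<le> y \<bullet> b' \<and> y \<bullet> b' < 1)"
      for y s
    proof -
      have "(y - s *\<^sub>R b) \<bullet> b' = (if b' = b then y \<bullet> b - s else y \<bullet> b')" if "b' \<in> Basis" for b'
        using that bb by (simp add: inner_diff_left)
      then show ?thesis using b unfolding unit_cube_def by auto
    qed
    have m1: "x - t *\<^sub>R b \<in> ?C \<longleftrightarrow> x \<in> C1 \<or> x - b \<in> C2"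
      and m2: "\<not> (x \<in> C1 \<and> x - b \<in> C2)"
    proof -
      define Q where "Q \<longleftrightarrow> (\<forall>b'\<in>Basis - {b}. 0 \<le> x \<bullet> b' \<and> x \<bullet> b' < 1)"
      define a where "a = x \<bullet> b"
      have C: "x - s *\<^sub>R b \<in> ?C \<longleftrightarrow> 0 \<le> a - s \<and> a - s < 1 \<and> Q" for s
        using mem[of x s] unfolding Q_def a_def by blast
      have "x \<in> C1 \<longleftrightarrow> (0 \<le> a \<and> a < 1 \<and> Q) \<and> t \<le> a" using C[of 0] by (simp add: C1_def a_def)
      moreover have "x - b \<in> C2 \<longleftrightarrow> (0 \<le> a - 1 \<and> a - 1 < 1 \<and> Q) \<and> a - 1 < t"
        using C[of 1] bb(1) by (simp add: C2_def a_def inner_diff_left)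
      ultimately show "x - t *\<^sub>R b \<in> ?C \<longleftrightarrow> x \<in> C1 \<or> x - b \<in> C2" "\<not> (x \<in> C1 \<and> x - b \<in> C2)"
        using C[of t] t by (cases Q; auto)+
    qed
    show ?thesis using m1 m2 by (auto simp: indicator_def)
  qed
  have "(LINT x|torus. f (x + t *\<^sub>R b)) = (LINT x|lborel. indicator ?C ((x + t *\<^sub>R b) - t *\<^sub>R b) * f (x + t *\<^sub>R b))"
    by (simp add: torus_integral_eq)
  also have "\<dots> = (LINT x|lborel. indicator ?C (x - t *\<^sub>R b) * f x)"
    by (rule shift_int[of "\<lambda>x. indicator ?C (x - t *\<^sub>R b) * f x"]) measurable
  also have "\<dots> = (LINT x|lborel. indicator C1 x * f x + indicator C2 (x - b) * f x)"
    by (simp only: split distrib_right)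
  also have "\<dots> = (LINT x|lborel. indicator C1 x * f x + indicator C2 (x + (- b)) * f (x + (- b)))"
  proof -
    have "f x = f (x + (- b))" for x
      using per b unfolding torus_periodic_def by (metis diff_add_cancel add_uminus_conv_diff)
    then show ?thesis by simp
  qed
  also have "\<dots> = (LINT x|lborel. indicator C1 x * f x) + (LINT x|lborel. indicator C2 (x + (- b)) * f (x + (- b)))"
    by (intro Bochner_Integration.integral_add int shift_int2[of "\<lambda>x. indicator C2 x * f x"])
      (auto simp: C1_def C2_def)
  also have "(LINT x|lborel. indicator C2 (x + (- b)) * f (x + (- b))) = (LINT x|lborel. indicator C2 x * f x)"
    by (rule shift_int) measurable
  also have "(LINT x|lborel. indicator C1 x * f x) + (LINT x|lborel. indicator C2 x * f x)
    = (LINT x|lborel. indicator C1 x * f x + indicator C2 x * f x)"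
    by (intro Bochner_Integration.integral_add[symmetric] int) (auto simp: C1_def C2_def)
  also have "\<dots> = (LINT x|lborel. indicator ?C x * f x)"
    by (intro Bochner_Integration.integral_cong) (auto simp: C1_def C2_def split: split_indicator)
  also have "\<dots> = (LINT x|torus. f x)" by (simp add: torus_integral_eq)
  finally show ?thesis .
qed

text \<open>
  By translation invariance the difference quotients of \<open>\<psi>\<close> in the direction \<open>b\<close> have integral \<open>0\<close>; they are
  bounded by the mean value theorem, so this passes to the limit. Integration by parts, the integrals
  of the waves and thereby their orthogonality all come from this formula.
\<close>

lemma torus_integral_derivative:
  fixes \<psi> :: "'a::euclidean_space \<Rightarrow> real"
  assumes per: "torus_periodic \<psi>"
    and deriv: "\<And>x. (\<psi> has_derivative \<psi>' x) (at x)"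
    and cont: "continuous_on UNIV (\<lambda>x. \<psi>' x b)" and b: "b \<in> Basis"
  shows "(LINT x|torus. \<psi>' x b) = 0"
proof -
  have cont\<psi>: "continuous_on UNIV \<psi>"
    using deriv by (meson continuous_at_imp_continuous_on has_derivative_continuous)
  have [measurable]: "\<psi> \<in> borel_measurable borel" "(\<lambda>x. \<psi>' x b) \<in> borel_measurable borel"
    using borel_measurable_continuous_onI cont cont\<psi> by auto
  have line: "((\<lambda>t. \<psi> (x + t *\<^sub>R b)) has_real_derivative \<psi>' (x + s *\<^sub>R b) b) (at s)" for x s
  proof -
    have "((\<lambda>t. \<psi> (x + t *\<^sub>R b)) has_derivative (\<lambda>h. \<psi>' (x + s *\<^sub>R b) (h *\<^sub>R b))) (at s)"
      by (rule has_derivative_compose[OF _ deriv, of "\<lambda>t. x + t *\<^sub>R b"]) (auto intro!: derivative_eq_intros)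
    moreover have "(\<lambda>h. \<psi>' (x + s *\<^sub>R b) (h *\<^sub>R b)) = (*) (\<psi>' (x + s *\<^sub>R b) b)"
      using has_derivative_linear[OF deriv] by (auto simp: linear_cmul mult.commute)
    ultimately show ?thesis by (simp add: has_field_derivative_def)
  qed
  have per': "torus_periodic (\<lambda>x. \<psi>' x b)"
    unfolding torus_periodic_def
  proof safe
    fix c x :: 'a assume c: "c \<in> Basis"
    have "\<psi> (x + c + t *\<^sub>R b) = \<psi> (x + t *\<^sub>R b)" for t
    proof -
      have "x + c + t *\<^sub>R b = (x + t *\<^sub>R b) + c" by simp
      then show ?thesis using per c unfolding torus_periodic_def by metis
    qed
    then have "(\<lambda>t. \<psi> (x + c + t *\<^sub>R b)) = (\<lambda>t. \<psi> (x + t *\<^sub>R b))" by simp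
    then show "\<psi>' (x + c) b = \<psi>' x b"
      using DERIV_unique[OF line[of "x + c" 0]] line[of x 0] by simp
  qed
  obtain B where B: "\<And>x. norm (\<psi>' x b) \<le> B"
    using torus_periodic_continuous_bounded[OF per' cont] by blast
  define h where "h n = inverse (real (Suc n))" for n
  have h: "0 < h n" "h n \<le> 1" for n by (auto simp: h_def field_simps)
  have hlim: "h \<longlonglongrightarrow> 0" unfolding h_def[abs_def] by (rule LIMSEQ_inverse_real_of_nat)
  define q where "q n x = (\<psi> (x + h n *\<^sub>R b) - \<psi> x) / h n" for n x
  have [measurable]: "q n \<in> borel_measurable borel" for n unfolding q_def[abs_def] by measurable
  have qB: "norm (q n x) \<le> B" for n x
  proof -
    obtain z where "\<psi> (x + h n *\<^sub>R b) - \<psi> (x + 0 *\<^sub>R b) = (h n - 0) * \<psi>' (x + z *\<^sub>R b) b"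
      using MVT2[of 0 "h n" "\<lambda>t. \<psi> (x + t *\<^sub>R b)" "\<lambda>s. \<psi>' (x + s *\<^sub>R b) b"] h line by blast
    then have "q n x = \<psi>' (x + z *\<^sub>R b) b" using h(1)[of n] by (simp add: q_def)
    then show ?thesis using B by simp
  qed
  have lim: "(\<lambda>n. q n x) \<longlonglongrightarrow> \<psi>' x b" for x
  proof -
    have "((\<lambda>k. (\<psi> (x + (0 + k) *\<^sub>R b) - \<psi> (x + 0 *\<^sub>R b)) / k) \<longlongrightarrow> \<psi>' (x + 0 *\<^sub>R b) b) (at 0)"
      using line[of x 0] unfolding DERIV_def .
    moreover have "filterlim h (at 0) sequentially"
      using hlim h(1) by (auto simp: filterlim_at intro!: always_eventually) (metis less_irrefl)
    ultimately show ?thesis unfolding q_def by (auto dest: filterlim_compose)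
  qed
  have "(\<lambda>n. LINT x|torus. q n x) \<longlonglongrightarrow> (LINT x|torus. \<psi>' x b)"
    by (rule integral_dominated_convergence[where w="\<lambda>_. B"]) (use lim qB in auto)
  moreover have "(LINT x|torus. q n x) = 0" for n
  proof -
    have "torus_periodic (\<lambda>x. \<psi> (x + h n *\<^sub>R b))"
      unfolding torus_periodic_def
    proof safe
      fix c x :: 'a assume "c \<in> Basis"
      moreover have "x + c + h n *\<^sub>R b = (x + h n *\<^sub>R b) + c" by simp
      ultimately show "\<psi> (x + c + h n *\<^sub>R b) = \<psi> (x + h n *\<^sub>R b)"
        using per unfolding torus_periodic_def by metis
    qed
    then have "(LINT x|torus. \<psi> (x + h n *\<^sub>R b) - \<psi> x) = (LINT x|torus. \<psi> (x + h n *\<^sub>R b)) - (LINT x|torus. \<psi> x)"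
      using per cont\<psi>
      by (intro Bochner_Integration.integral_diff torus_periodic_continuous_integrable)
        (auto intro!: continuous_on_compose2[OF cont\<psi>] continuous_intros)
    then show ?thesis
      unfolding q_def using torus_integral_translate[OF per cont\<psi> b, of "h n"] h[of n] by simp
  qed
  ultimately show ?thesis by (simp add: LIMSEQ_const_iff)
qed

lemma has_derivative_imp_GDERIV:
  fixes f :: "'a::euclidean_space \<Rightarrow> real"
  assumes "(f has_derivative f') (at x)"
  shows "GDERIV f x :> (\<Sum>b\<in>Basis. f' b *\<^sub>R b)"
proof -
  have "f' h = h \<bullet> (\<Sum>b\<in>Basis. f' b *\<^sub>R b)" for h
  proof -
    have lin: "linear f'" by (rule has_derivative_linear[OF assms])
    have "f' h = f' (\<Sum>b\<in>Basis. (h \<bullet> b) *\<^sub>R b)" by (simp add: euclidean_representation)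
    also have "\<dots> = (\<Sum>b\<in>Basis. (h \<bullet> b) * f' b)" by (simp add: linear_sum[OF lin] linear_cmul[OF lin])
    finally show ?thesis by (simp add: inner_sum_right mult.commute)
  qed
  then have "f' = (\<lambda>h. h \<bullet> (\<Sum>b\<in>Basis. f' b *\<^sub>R b))" by (rule ext)
  with assms show ?thesis unfolding gderiv_def by metis
qed

lemma gradient_eqI:
  fixes f :: "'a::euclidean_space \<Rightarrow> real"
  assumes "GDERIV f x :> D"
  shows "gradient f x = D"
  unfolding gradient_def
proof (rule the_equality)
  show "GDERIV f x :> D" by (rule assms)
  fix D' assume "GDERIV f x :> D'"
  with assms have "(\<lambda>h. h \<bullet> D) = (\<lambda>h. h \<bullet> D')"
    unfolding gderiv_def by (rule has_derivative_unique)
  then show "D' = D" by (metis vector_eq_rdot inner_commute)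
qed

lemma gradient_eq_sum:
  fixes f :: "'a::euclidean_space \<Rightarrow> real"
  assumes "(f has_derivative f') (at x)"
  shows "gradient f x = (\<Sum>b\<in>Basis. f' b *\<^sub>R b)"
  using assms by (intro gradient_eqI has_derivative_imp_GDERIV)

lemma torus_smoothD:
  fixes \<phi> :: "'a::euclidean_space \<Rightarrow> real"
  assumes "torus_smooth \<phi>"
  shows "torus_periodic \<phi>" "continuous_on UNIV \<phi>"
    and "(\<phi> has_derivative frechet_derivative \<phi> (at x)) (at x)"
    and "continuous_on UNIV (\<lambda>x. frechet_derivative \<phi> (at x) v)"
    and "(\<phi> has_derivative (\<lambda>h. h \<bullet> gradient \<phi> x)) (at x)"
    and "continuous_on UNIV (gradient \<phi>)" "torus_periodic (gradient \<phi>)"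
proof -
  show per: "torus_periodic \<phi>" using assms by (simp add: torus_smooth_def)
  have 0: "C_k 0 \<phi>" "C_k (Suc 0) \<phi>" using assms unfolding torus_smooth_def by blast+
  then show "continuous_on UNIV \<phi>" by simp
  show deriv: "(\<phi> has_derivative frechet_derivative \<phi> (at x)) (at x)" for x
    using 0 by (simp add: frechet_derivative_works[symmetric])
  show cont: "continuous_on UNIV (\<lambda>x. frechet_derivative \<phi> (at x) v)" for v
    using 0 by simp
  have grad: "gradient \<phi> = (\<lambda>x. \<Sum>b\<in>Basis. frechet_derivative \<phi> (at x) b *\<^sub>R b)"
    using gradient_eq_sum[OF deriv] by blast
  show "(\<phi> has_derivative (\<lambda>h. h \<bullet> gradient \<phi> x)) (at x)"
    using has_derivative_imp_GDERIV[OF deriv, of x] by (simp add: gderiv_def grad)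
  show "continuous_on UNIV (gradient \<phi>)"
    unfolding grad by (intro continuous_intros cont)
  show "torus_periodic (gradient \<phi>)"
    unfolding torus_periodic_def
  proof safe
    fix c x :: 'a assume c: "c \<in> Basis"
    have "(\<phi> has_derivative frechet_derivative \<phi> (at (x + c))) (at (x + c))" by (rule deriv)
    then have "((\<lambda>y. \<phi> (y + c)) has_derivative (\<lambda>h. frechet_derivative \<phi> (at (x + c)) h)) (at x)"
      by (intro has_derivative_compose[of "\<lambda>y. y + c" "\<lambda>h. h" x UNIV \<phi>]) (auto intro!: derivative_eq_intros)
    moreover have "(\<lambda>y. \<phi> (y + c)) = \<phi>" using per c by (auto simp: torus_periodic_def)
    ultimately have "frechet_derivative \<phi> (at (x + c)) = frechet_derivative \<phi> (at x)"
      using has_derivative_unique[OF _ deriv] by simp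
    then show "gradient \<phi> (x + c) = gradient \<phi> x" by (simp add: grad)
  qed
qed

lemma torus_L2_real_iff: "f \<in> torus_L2 \<longleftrightarrow> torus_periodic f \<and> f \<in> borel_measurable borel \<and> integrable torus (\<lambda>x. (f x)\<^sup>2)"
  for f :: "'a::euclidean_space \<Rightarrow> real"
  by (simp add: torus_L2_def)

lemma torus_L2_inner_integrable:
  "f \<in> torus_L2 \<Longrightarrow> g \<in> torus_L2 \<Longrightarrow> integrable torus (\<lambda>x. f x \<bullet> g x)"
  unfolding torus_L2_def by (intro inner_square_integrable) auto

lemma torus_L2_scaleR_integrable:
  fixes f :: "'a::euclidean_space \<Rightarrow> real" and g :: "'a \<Rightarrow> 'b::euclidean_space"
  assumes "f \<in> torus_L2" "g \<in> torus_L2"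
  shows "integrable torus (\<lambda>x. f x *\<^sub>R g x)"
proof (rule Bochner_Integration.integrable_bound)
  show "integrable torus (\<lambda>x. (norm (f x))\<^sup>2 + (norm (g x))\<^sup>2)" using assms by (auto simp: torus_L2_def)
  show "AE x in torus. norm (f x *\<^sub>R g x) \<le> norm ((norm (f x))\<^sup>2 + (norm (g x))\<^sup>2)"
  proof (rule AE_I2)
    fix x
    have "\<bar>f x\<bar> * norm (g x) \<le> (norm (f x))\<^sup>2 + (norm (g x))\<^sup>2"
      using sum_squares_bound[of "norm (f x)" "norm (g x)"] mult_nonneg_nonneg[OF norm_ge_zero norm_ge_zero, of "f x" "g x"]
      unfolding real_norm_def by linarith
    then show "norm (f x *\<^sub>R g x) \<le> norm ((norm (f x))\<^sup>2 + (norm (g x))\<^sup>2)" by simp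
  qed
  have [measurable]: "f \<in> borel_measurable borel" "g \<in> borel_measurable borel" using assms by (auto simp: torus_L2_def)
  show "(\<lambda>x. f x *\<^sub>R g x) \<in> borel_measurable torus" by measurable
qed

lemma torus_L2_add: "f \<in> torus_L2 \<Longrightarrow> g \<in> torus_L2 \<Longrightarrow> (\<lambda>x. f x + g x) \<in> torus_L2"
  using add_square_integrable[of f torus g] unfolding torus_L2_def torus_periodic_def
  by (simp add: borel_measurable_add)

lemma torus_L2_scale: "f \<in> torus_L2 \<Longrightarrow> (\<lambda>x. c *\<^sub>R f x) \<in> torus_L2"
  unfolding torus_L2_def torus_periodic_def
  by (simp add: power_mult_distrib borel_measurable_scaleR)

lemma torus_smooth_L2:
  assumes "torus_smooth \<phi>" shows "\<phi> \<in> torus_L2" "gradient \<phi> \<in> torus_L2"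
  using torus_smoothD[OF assms] by (auto intro: torus_periodic_continuous_L2)

text \<open>
  Integration by parts: the derivative of \<open>\<phi> \<psi>\<close> has integral \<open>0\<close>.
\<close>

lemma torus_smooth_has_weak_gradient:
  fixes \<phi> :: "'a::euclidean_space \<Rightarrow> real"
  assumes \<phi>: "torus_smooth \<phi>"
  shows "has_weak_gradient \<phi> (gradient \<phi>)"
  unfolding has_weak_gradient_def
proof (intro conjI allI impI)
  show "gradient \<phi> \<in> torus_L2" using torus_smooth_L2[OF \<phi>] by simp
  fix \<psi> :: "'a \<Rightarrow> real" assume \<psi>: "torus_smooth \<psi>"
  note ints = torus_L2_scaleR_integrable[OF torus_smooth_L2(1)[OF \<phi>] torus_smooth_L2(2)[OF \<psi>]]
    torus_L2_scaleR_integrable[OF torus_smooth_L2(1)[OF \<psi>] torus_smooth_L2(2)[OF \<phi>]]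
  have "(LINT x|torus. \<phi> x *\<^sub>R gradient \<psi> x + \<psi> x *\<^sub>R gradient \<phi> x) = 0"
  proof (rule euclidean_eqI)
    fix b :: 'a assume b: "b \<in> Basis"
    let ?D = "\<lambda>x v. \<phi> x * (v \<bullet> gradient \<psi> x) + (v \<bullet> gradient \<phi> x) * \<psi> x"
    have "(LINT x|torus. ?D x b) = 0"
    proof (rule torus_integral_derivative[where \<psi>="\<lambda>x. \<phi> x * \<psi> x"])
      show "torus_periodic (\<lambda>x. \<phi> x * \<psi> x)"
        using torus_smoothD(1)[OF \<phi>] torus_smoothD(1)[OF \<psi>] by (simp add: torus_periodic_def)
      show "((\<lambda>x. \<phi> x * \<psi> x) has_derivative ?D x) (at x)" for x
        by (rule has_derivative_mult) (intro torus_smoothD \<phi> \<psi>)+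
      show "continuous_on UNIV (\<lambda>x. ?D x b)"
        by (intro continuous_intros torus_smoothD \<phi> \<psi>)
    qed (rule b)
    then show "(LINT x|torus. \<phi> x *\<^sub>R gradient \<psi> x + \<psi> x *\<^sub>R gradient \<phi> x) \<bullet> b = 0 \<bullet> b"
    proof -
      have "(LINT x|torus. \<phi> x *\<^sub>R gradient \<psi> x + \<psi> x *\<^sub>R gradient \<phi> x) \<bullet> b
        = (LINT x|torus. (\<phi> x *\<^sub>R gradient \<psi> x + \<psi> x *\<^sub>R gradient \<phi> x) \<bullet> b)"
        using ints by (intro integral_inner_left[symmetric] Bochner_Integration.integrable_add)
      also have "\<dots> = (LINT x|torus. ?D x b)"
        by (intro Bochner_Integration.integral_cong) (simp_all add: inner_add_left inner_add_right inner_commute mult.commute)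
      finally show ?thesis using \<open>(LINT x|torus. ?D x b) = 0\<close> by simp
    qed
  qed
  then show "(LINT x|torus. \<phi> x *\<^sub>R gradient \<psi> x) = - (LINT x|torus. \<psi> x *\<^sub>R gradient \<phi> x)"
    using ints by (simp add: eq_neg_iff_add_eq_0)
qed

section \<open>Products of Hartley waves\<close>

text \<open>
  The Hartley functions \<open>cos + sin\<close>, indexed by positive and negative integers, replace the two families of
  cosines and sines: they are real, orthonormal without normalizing factors, and the derivative
  of \<open>cas k\<close> is a multiple of \<open>cas (- k)\<close>, so that no case distinctions arise.
\<close>

definition cas :: "int \<Rightarrow> real \<Rightarrow> real" where
  "cas k t = cos (2 * pi * of_int k * t) + sin (2 * pi * of_int k * t)"

lemma cas_0 [simp]: "cas 0 t = 1"
  by (simp add: cas_def)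

lemma cas_periodic: "cas k (t + 1) = cas k t"
  using cos_int_2pin[of k] sin_int_2pin[of k]
  by (simp add: cas_def distrib_left cos_add sin_add)

lemma cas_has_derivative: "(cas k has_real_derivative 2 * pi * of_int k * cas (- k) t) (at t)"
  unfolding cas_def[abs_def] by (auto intro!: derivative_eq_intros simp: algebra_simps)

lemma cas_continuous: "continuous_on UNIV (cas k)"
  unfolding cas_def[abs_def] by (intro continuous_intros)

text \<open>
  A product of two Hartley functions is a combination of four of them: the difference frequencies
  carry the cosine of the difference of the arguments, the sum frequencies the sine of their sum.
\<close>

definition product_mode :: "int \<Rightarrow> int \<Rightarrow> nat \<Rightarrow> int" where
  "product_mode k l s = [k - l, l - k, k + l, - k - l] ! s"

definition product_coeff :: "nat \<Rightarrow> real" where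
  "product_coeff s = [1/2, 1/2, 1/2, -1/2] ! s"

lemma sum_lessThan_4: "(\<Sum>s<4. f s) = f 0 + f 1 + f 2 + f (3::nat)" for f :: "nat \<Rightarrow> real"
  by (simp add: eval_nat_numeral)

lemma cas_mult:
  "cas k t * cas l t = (\<Sum>s<4. product_coeff s * cas (product_mode k l s) t)"
proof -
  define a b where "a = 2 * pi * of_int k * t" and "b = 2 * pi * of_int l * t"
  have "2 * pi * of_int (k - l) * t = a - b" "2 * pi * of_int (l - k) * t = b - a"
    "2 * pi * of_int (k + l) * t = a + b" "2 * pi * of_int (- k - l) * t = - a - b"
    by (simp_all add: a_def b_def algebra_simps)
  then have "cas (k - l) t = cos (a - b) + sin (a - b)" "cas (l - k) t = cos (b - a) + sin (b - a)"
    "cas (k + l) t = cos (a + b) + sin (a + b)" "cas (- k - l) t = cos (- a - b) + sin (- a - b)"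
    unfolding cas_def by presburger+
  then have "(\<Sum>s<4. product_coeff s * cas (product_mode k l s) t)
    = (cos (a - b) + sin (a - b) + (cos (b - a) + sin (b - a)) + (cos (a + b) + sin (a + b))
        - (cos (- a - b) + sin (- a - b))) / 2"
    unfolding sum_lessThan_4 by (simp add: product_coeff_def product_mode_def add_divide_distrib diff_divide_distrib)
  also have "\<dots> = (cos a + sin a) * (cos b + sin b)"
    by (simp add: cos_add sin_add cos_diff sin_diff algebra_simps)
  finally show ?thesis by (simp add: cas_def a_def b_def)
qed

definition wave :: "('d::finite \<Rightarrow> int) \<Rightarrow> real^'d \<Rightarrow> real" where
  "wave \<kappa> z = (\<Prod>j\<in>UNIV. cas (\<kappa> j) (z $ j))"

text \<open>
  Expanding the product over all coordinates: \<open>s\<close> selects one of the four terms in each coordinate.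
\<close>

lemma wave_mult:
  "wave \<kappa> z * wave \<mu> z = (\<Sum>s\<in>PiE UNIV (\<lambda>_. {..<4}). (\<Prod>j\<in>UNIV. product_coeff (s j)) *
      wave (\<lambda>j. product_mode (\<kappa> j) (\<mu> j) (s j)) z)"
proof -
  have "wave \<kappa> z * wave \<mu> z
    = (\<Prod>j\<in>UNIV. \<Sum>s<4. product_coeff s * cas (product_mode (\<kappa> j) (\<mu> j) s) (z $ j))"
    by (simp add: wave_def cas_mult flip: prod.distrib)
  also have "\<dots> = (\<Sum>s\<in>PiE UNIV (\<lambda>_. {..<4}). \<Prod>j\<in>UNIV.
      product_coeff (s j) * cas (product_mode (\<kappa> j) (\<mu> j) (s j)) (z $ j))"
    by (rule prod_sum_PiE) auto
  finally show ?thesis by (simp add: wave_def prod.distrib)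
qed

abbreviation flip_mode :: "('d \<Rightarrow> int) \<Rightarrow> 'd \<Rightarrow> 'd \<Rightarrow> int" where
  "flip_mode \<kappa> j \<equiv> \<kappa>(j := - \<kappa> j)"

lemma wave_has_derivative:
  fixes \<kappa> :: "'d::finite \<Rightarrow> int"
  shows "(wave \<kappa> has_derivative (\<lambda>h. \<Sum>j\<in>UNIV. h $ j * (2 * pi * of_int (\<kappa> j) * wave (flip_mode \<kappa> j) z))) (at z)"
proof -
  have "((\<lambda>z. \<Prod>j\<in>UNIV. cas (\<kappa> j) (z $ j)) has_derivative
    (\<lambda>h. \<Sum>j\<in>UNIV. (2 * pi * of_int (\<kappa> j) * cas (- \<kappa> j) (z $ j)) * (h $ j) * (\<Prod>i\<in>UNIV - {j}. cas (\<kappa> i) (z $ i)))) (at z)"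
  proof (rule has_derivative_prod)
    fix j :: 'd
    have "((\<lambda>z. cas (\<kappa> j) (z $ j)) has_derivative (\<lambda>h. (*) (2 * pi * of_int (\<kappa> j) * cas (- \<kappa> j) (z $ j)) (h $ j))) (at z)"
      by (rule has_derivative_compose[OF _ cas_has_derivative[unfolded has_field_derivative_def]])
        (rule bounded_linear.has_derivative[OF bounded_linear_vec_nth], rule has_derivative_ident)
    then show "((\<lambda>z. cas (\<kappa> j) (z $ j)) has_derivative (\<lambda>h. 2 * pi * of_int (\<kappa> j) * cas (- \<kappa> j) (z $ j) * h $ j)) (at z)"
      by simp
  qed
  moreover have "cas (- \<kappa> j) (z $ j) * (\<Prod>i\<in>UNIV - {j}. cas (\<kappa> i) (z $ i)) = wave (flip_mode \<kappa> j) z" for j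
  proof -
    have "wave (flip_mode \<kappa> j) z = cas (- \<kappa> j) (z $ j) * (\<Prod>i\<in>UNIV - {j}. cas (flip_mode \<kappa> j i) (z $ i))"
      unfolding wave_def by (subst prod.remove[of UNIV j]) auto
    also have "(\<Prod>i\<in>UNIV - {j}. cas (flip_mode \<kappa> j i) (z $ i)) = (\<Prod>i\<in>UNIV - {j}. cas (\<kappa> i) (z $ i))"
      by (intro prod.cong) auto
    finally show ?thesis ..
  qed
  moreover have "wave \<kappa> = (\<lambda>z. \<Prod>j\<in>UNIV. cas (\<kappa> j) (z $ j))" by (simp add: wave_def fun_eq_iff)
  ultimately show ?thesis by (simp add: mult.assoc mult.left_commute)
qed

inductive trig_poly :: "(real^'d::finite \<Rightarrow> real) \<Rightarrow> bool" where
  wave: "trig_poly (wave \<kappa>)"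
| add: "trig_poly f \<Longrightarrow> trig_poly g \<Longrightarrow> trig_poly (\<lambda>z. f z + g z)"
| scale: "trig_poly f \<Longrightarrow> trig_poly (\<lambda>z. c * f z)"

lemma trig_poly_const: "trig_poly (\<lambda>z. c)"
  using trig_poly.scale[OF trig_poly.wave[of "\<lambda>_. 0"], of c] by (simp add: wave_def)

lemma trig_poly_sum: "(\<And>k. k \<in> I \<Longrightarrow> trig_poly (f k)) \<Longrightarrow> trig_poly (\<lambda>z. \<Sum>k\<in>I. f k z)"
  by (induction I rule: infinite_finite_induct) (simp_all add: trig_poly_const trig_poly.add)

lemma trig_poly_mult: "trig_poly f \<Longrightarrow> trig_poly g \<Longrightarrow> trig_poly (\<lambda>z. f z * g z)"
proof (induction f rule: trig_poly.induct)
  case (wave \<kappa>)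
  show ?case using wave
  proof (induction g rule: trig_poly.induct)
    case (wave \<mu>)
    show ?case unfolding wave_mult by (intro trig_poly_sum trig_poly.scale trig_poly.wave)
  next
    case (add f g)
    then show ?case using trig_poly.add[OF add.IH] by (simp add: distrib_left)
  next
    case (scale f c)
    then show ?case using trig_poly.scale[OF scale.IH, of c] by (simp add: mult.left_commute)
  qed
next
  case (add f1 f2)
  then show ?case using trig_poly.add[OF add.IH(1) add.IH(2)] by (simp add: distrib_right)
next
  case (scale f c)
  then show ?case using trig_poly.scale[of "\<lambda>z. f z * g z" c] by (simp add: mult.assoc)
qed

text \<open>
  Derivatives stay in the class, which is why smoothness follows by induction on the order.
\<close>

lemma trig_poly_has_derivative:
  assumes "trig_poly f"
  shows "\<exists>D. (\<forall>z. (f has_derivative D z) (at z)) \<and> (\<forall>v. trig_poly (\<lambda>z. D z v))"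
  using assms
proof (induction rule: trig_poly.induct)
  case (wave \<kappa>)
  show ?case
    by (intro exI[of _ "\<lambda>z h. \<Sum>j\<in>UNIV. h $ j * (2 * pi * of_int (\<kappa> j) * wave (flip_mode \<kappa> j) z)"]
        conjI allI wave_has_derivative trig_poly_sum trig_poly.scale trig_poly.wave)
next
  case (add f g)
  then obtain D E where "\<forall>z. (f has_derivative D z) (at z)" "\<forall>v. trig_poly (\<lambda>z. D z v)"
    "\<forall>z. (g has_derivative E z) (at z)" "\<forall>v. trig_poly (\<lambda>z. E z v)" by blast
  then show ?case
    by (intro exI[of _ "\<lambda>z h. D z h + E z h"] conjI allI has_derivative_add trig_poly.add) blast+
next
  case (scale f c)
  then obtain D where "\<forall>z. (f has_derivative D z) (at z)" "\<forall>v. trig_poly (\<lambda>z. D z v)" by blast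
  then show ?case
    by (intro exI[of _ "\<lambda>z h. c * D z h"] conjI allI has_derivative_mult_right trig_poly.scale) blast+
qed

lemma trig_poly_torus_smooth:
  assumes "trig_poly (f :: real^'d::finite \<Rightarrow> real)"
  shows "torus_smooth f"
  unfolding torus_smooth_def
proof (intro conjI allI)
  show "torus_periodic f"
    using assms
  proof (induction rule: trig_poly.induct)
    case (wave \<kappa>)
    have "cas (\<kappa> i) ((x + axis j 1) $ i) = cas (\<kappa> i) (x $ i)" for x :: "real^'d" and i j
      by (cases "i = j") (simp_all add: axis_def cas_periodic)
    then show ?case by (auto simp: torus_periodic_def wave_def Basis_vec_def)
  qed (auto simp: torus_periodic_def)
  show "C_k k f" for k
    using assms
  proof (induction k arbitrary: f)
    case 0
    then obtain D where "\<forall>z. (f has_derivative D z) (at z)" using trig_poly_has_derivative by blast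
    then show ?case by (auto intro!: continuous_at_imp_continuous_on has_derivative_continuous)
  next
    case (Suc k)
    then obtain D where D: "\<And>z. (f has_derivative D z) (at z)" "\<And>v. trig_poly (\<lambda>z. D z v)"
      using trig_poly_has_derivative by blast
    have "frechet_derivative f (at z) = D z" for z using frechet_derivative_at[OF D(1)] by simp
    then show ?case using D Suc.IH by (auto simp: differentiable_def)
  qed
qed

lemma cas_torus_smooth: "torus_smooth (cas k)"
  unfolding torus_smooth_def
proof (intro conjI allI)
  show "torus_periodic (cas k)" by (simp add: torus_periodic_def cas_periodic)
  have "C_k n (\<lambda>t. c * cas k t)" for n c
  proof (induction n arbitrary: c k)
    case 0
    show ?case by (auto intro!: continuous_intros cas_continuous)
  next
    case (Suc n)
    have deriv: "((\<lambda>t. c * cas k t) has_derivative (\<lambda>v. (c * (2 * pi * of_int k * cas (- k) t)) * v)) (at t)" for t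
      using DERIV_cmult[OF cas_has_derivative, of c k t] by (simp add: has_field_derivative_def)
    have "frechet_derivative (\<lambda>t. c * cas k t) (at t) v = (c * (2 * pi * of_int k) * v) * cas (- k) t" for t v
      unfolding frechet_derivative_at[OF deriv, of t, symmetric] by (simp add: mult.assoc mult.left_commute mult.commute)
    then show ?case using deriv Suc by (auto simp: differentiable_def)
  qed
  from this[of _ 1] show "C_k n (cas k)" for n by simp
qed

lemma wave_gradient: "gradient (wave \<kappa>) z $ j = 2 * pi * of_int (\<kappa> j) * wave (flip_mode \<kappa> j) z"
proof -
  have "h \<bullet> gradient (wave \<kappa>) z = h \<bullet> (\<chi> j. 2 * pi * of_int (\<kappa> j) * wave (flip_mode \<kappa> j) z)" for h
  proof -
    have "h \<bullet> gradient (wave \<kappa>) z = (\<Sum>j\<in>UNIV. h $ j * (2 * pi * of_int (\<kappa> j) * wave (flip_mode \<kappa> j) z))"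
      by (rule fun_cong[OF has_derivative_unique[OF
          torus_smoothD(5)[OF trig_poly_torus_smooth[OF trig_poly.wave]] wave_has_derivative]])
    then show ?thesis by (simp only: inner_vec_def vec_lambda_beta inner_real_def)
  qed
  then have "gradient (wave \<kappa>) z = (\<chi> j. 2 * pi * of_int (\<kappa> j) * wave (flip_mode \<kappa> j) z)"
    using vector_eq_ldot[of "gradient (wave \<kappa>) z"] by blast
  then show ?thesis by simp
qed

lemma torus_integral_cas: "k \<noteq> 0 \<Longrightarrow> (LINT t|torus. cas k t) = 0"
proof -
  assume k: "k \<noteq> 0"
  have "(LINT t|torus. (2 * pi * of_int (- k) * cas k t) * 1) = 0"
  proof (rule torus_integral_derivative[where \<psi>="cas (- k)" and \<psi>'="\<lambda>t v. (2 * pi * of_int (- k) * cas k t) * v"])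
    show "torus_periodic (cas (- k))" by (simp add: torus_periodic_def cas_periodic)
    show "(cas (- k) has_derivative (*) (2 * pi * of_int (- k) * cas k t)) (at t)" for t
      using cas_has_derivative[of "- k" t] by (simp add: has_field_derivative_def)
    show "continuous_on UNIV (\<lambda>t. 2 * pi * of_int (- k) * cas k t * 1)"
      by (intro continuous_intros cas_continuous)
  qed simp
  then show ?thesis using k by simp
qed

lemma torus_integral_wave:
  fixes \<kappa> :: "'d::finite \<Rightarrow> int"
  shows "(LINT z|torus. wave \<kappa> z) = (if \<kappa> = (\<lambda>_. 0) then 1 else 0)"
proof (cases "\<kappa> = (\<lambda>_. 0)")
  case True
  then show ?thesis using torus.prob_space by (simp add: wave_def)
next
  case False
  then obtain j where j: "\<kappa> j \<noteq> 0" by auto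
  let ?\<mu> = "flip_mode \<kappa> j"
  let ?D = "\<lambda>z h. \<Sum>i\<in>UNIV. h $ i * (2 * pi * of_int (?\<mu> i) * wave (flip_mode ?\<mu> i) z)"
  have D: "?D z (axis j 1) = - (2 * pi * of_int (\<kappa> j)) * wave \<kappa> z" for z
  proof -
    have "?D z (axis j 1) = (\<Sum>i\<in>UNIV. if i = j then 2 * pi * of_int (?\<mu> i) * wave (flip_mode ?\<mu> i) z else 0)"
      by (intro sum.cong) (auto simp: axis_def)
    then show ?thesis by simp
  qed
  have "(LINT z|torus. ?D z (axis j 1)) = 0"
  proof (rule torus_integral_derivative[where \<psi>="wave ?\<mu>" and \<psi>'="?D"])
    show "torus_periodic (wave ?\<mu>)" by (rule torus_smoothD[OF trig_poly_torus_smooth[OF trig_poly.wave]])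
    show "(wave ?\<mu> has_derivative ?D z) (at z)" for z by (rule wave_has_derivative)
    show "continuous_on UNIV (\<lambda>z. ?D z (axis j 1))"
      by (intro continuous_intros torus_smoothD[OF trig_poly_torus_smooth[OF trig_poly.wave]])
    show "axis j (1::real) \<in> Basis" by (simp add: axis_in_Basis_iff)
  qed
  then show ?thesis unfolding D using False j by simp
qed

text \<open>
  After expanding with \<open>wave_mult\<close> only constant terms contribute, and the sum over the selections \<open>s\<close>
  factors again into a product of one-dimensional Kronecker symbols.
\<close>

lemma wave_orthonormal:
  fixes \<kappa> \<mu> :: "'d::finite \<Rightarrow> int"
  shows "(LINT z|torus. wave \<kappa> z * wave \<mu> z) = (if \<kappa> = \<mu> then 1 else 0)"
proof -
  let ?P = "PiE UNIV (\<lambda>_. {..<4}) :: ('d \<Rightarrow> nat) set"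
  let ?m = "\<lambda>s j. product_mode (\<kappa> j) (\<mu> j) (s j)"
  have int: "integrable torus (wave \<eta>)" for \<eta> :: "'d \<Rightarrow> int"
    using torus_smoothD[OF trig_poly_torus_smooth[OF trig_poly.wave]]
    by (intro torus_periodic_continuous_integrable)
  have "(LINT z|torus. wave \<kappa> z * wave \<mu> z)
    = (\<Sum>s\<in>?P. (\<Prod>j\<in>UNIV. product_coeff (s j)) * (LINT z|torus. wave (?m s) z))"
    unfolding wave_mult by (simp add: int)
  also have "\<dots> = (\<Sum>s\<in>?P. \<Prod>j\<in>UNIV. product_coeff (s j) * (if ?m s j = 0 then 1 else 0))"
  proof (intro sum.cong refl)
    fix s
    have "(LINT z|torus. wave (?m s) z) = (\<Prod>j\<in>UNIV. if ?m s j = 0 then 1 else 0)"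
      unfolding torus_integral_wave by (auto simp: fun_eq_iff)
    then show "(\<Prod>j\<in>UNIV. product_coeff (s j)) * (LINT z|torus. wave (?m s) z)
      = (\<Prod>j\<in>UNIV. product_coeff (s j) * (if ?m s j = 0 then 1 else 0))" by (simp add: prod.distrib)
  qed
  also have "\<dots> = (\<Prod>j\<in>UNIV. \<Sum>s<4. product_coeff s * (if product_mode (\<kappa> j) (\<mu> j) s = 0 then 1 else 0))"
    by (rule prod_sum_PiE[symmetric]) auto
  also have "\<dots> = (\<Prod>j\<in>UNIV. if \<kappa> j = \<mu> j then 1 else 0)"
    by (intro prod.cong refl, unfold sum_lessThan_4) (auto simp: product_coeff_def product_mode_def)
  also have "\<dots> = (if \<kappa> = \<mu> then 1 else 0)" by (auto simp: fun_eq_iff)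
  finally show ?thesis .
qed

text \<open>
  A cube of frequencies, because it has to be invariant under all sign changes \<open>flip_mode\<close> for the
  partial sums to commute with differentiation.
\<close>

definition modes :: "nat \<Rightarrow> ('d::finite \<Rightarrow> int) set" where
  "modes N = {\<kappa>. \<forall>j. \<bar>\<kappa> j\<bar> \<le> int N}"

lemma finite_modes [simp]: "finite (modes N :: ('d::finite \<Rightarrow> int) set)"
proof -
  have "(modes N :: ('d \<Rightarrow> int) set) = PiE UNIV (\<lambda>_. {- int N..int N})"
    by (auto simp: modes_def PiE_def Pi_def abs_le_iff minus_le_iff)
  then show ?thesis by (simp add: finite_PiE)
qed

lemma flip_mode_in_modes [simp]: "flip_mode \<kappa> j \<in> modes N \<longleftrightarrow> \<kappa> \<in> modes N"
  unfolding modes_def by auto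

lemma flip_mode_flip_mode [simp]: "flip_mode (flip_mode \<kappa> j) j = \<kappa>"
  by auto

lemma trig_poly_expansion:
  assumes "trig_poly f"
  shows "\<exists>N0. \<forall>N\<ge>N0. \<exists>c. f = (\<lambda>z. \<Sum>\<kappa>\<in>modes N. c \<kappa> * wave \<kappa> z)"
  using assms
proof (induction rule: trig_poly.induct)
  case (wave \<kappa>)
  define N0 where "N0 = nat (Max (range (\<lambda>j. \<bar>\<kappa> j\<bar>)))"
  have "\<bar>\<kappa> j\<bar> \<le> int N0" for j
  proof -
    have "\<bar>\<kappa> j\<bar> \<le> Max (range (\<lambda>j. \<bar>\<kappa> j\<bar>))" by (rule Max_ge) auto
    then show ?thesis unfolding N0_def by linarith
  qed
  then have mem: "\<kappa> \<in> modes N" if "N \<ge> N0" for N     using that order_trans[OF \<open>\<And>j. \<bar>\<kappa> j\<bar> \<le> int N0\<close>, of "int N"] by (simp add: modes_def)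
  have "wave \<kappa> = (\<lambda>z. \<Sum>\<mu>\<in>modes N. (if \<mu> = \<kappa> then 1 else 0) * wave \<mu> z)" if "N \<ge> N0" for N
  proof
    fix z
    have "(\<Sum>\<mu>\<in>modes N. (if \<mu> = \<kappa> then 1 else 0) * wave \<mu> z) = (\<Sum>\<mu>\<in>modes N. if \<mu> = \<kappa> then wave \<mu> z else 0)"
      by (intro sum.cong) auto
    then show "wave \<kappa> z = (\<Sum>\<mu>\<in>modes N. (if \<mu> = \<kappa> then 1 else 0) * wave \<mu> z)" using mem[OF that] by simp
  qed
  then show ?case by (intro exI[of _ N0] allI impI exI)
next
  case (add f g)
  from add.IH(1) obtain M where M: "\<forall>n\<ge>M. \<exists>c. f = (\<lambda>z. \<Sum>\<kappa>\<in>modes n. c \<kappa> * wave \<kappa> z)" ..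
  from add.IH(2) obtain N where N: "\<forall>n\<ge>N. \<exists>c. g = (\<lambda>z. \<Sum>\<kappa>\<in>modes n. c \<kappa> * wave \<kappa> z)" ..
  show ?case
  proof (intro exI[of _ "max M N"] allI impI)
    fix n assume "max M N \<le> n"
    then have n: "M \<le> n" "N \<le> n" by simp_all
    obtain c where c: "f = (\<lambda>z. \<Sum>\<kappa>\<in>modes n. c \<kappa> * wave \<kappa> z)" using M n(1) by blast
    obtain c' where c': "g = (\<lambda>z. \<Sum>\<kappa>\<in>modes n. c' \<kappa> * wave \<kappa> z)" using N n(2) by blast
    from c c' have "(\<lambda>z. f z + g z) = (\<lambda>z. \<Sum>\<kappa>\<in>modes n. (c \<kappa> + c' \<kappa>) * wave \<kappa> z)"
      by (simp add: sum.distrib distrib_right)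
    then show "\<exists>c. (\<lambda>z. f z + g z) = (\<lambda>z. \<Sum>\<kappa>\<in>modes n. c \<kappa> * wave \<kappa> z)"
      by (rule exI[of _ "\<lambda>\<kappa>. c \<kappa> + c' \<kappa>"])
  qed
next
  case (scale f a)
  from scale.IH obtain M where M: "\<forall>n\<ge>M. \<exists>c. f = (\<lambda>z. \<Sum>\<kappa>\<in>modes n. c \<kappa> * wave \<kappa> z)" ..
  show ?case
  proof (intro exI[of _ M] allI impI)
    fix n assume "M \<le> n"
    with M have "\<exists>c. f = (\<lambda>z. \<Sum>\<kappa>\<in>modes n. c \<kappa> * wave \<kappa> z)" by simp
    then obtain c where "f = (\<lambda>z. \<Sum>\<kappa>\<in>modes n. c \<kappa> * wave \<kappa> z)" ..
    then have "(\<lambda>z. a * f z) = (\<lambda>z. \<Sum>\<kappa>\<in>modes n. (a * c \<kappa>) * wave \<kappa> z)"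
      by (simp add: sum_distrib_left mult.assoc)
    then show "\<exists>c. (\<lambda>z. a * f z) = (\<lambda>z. \<Sum>\<kappa>\<in>modes n. c \<kappa> * wave \<kappa> z)"
      by (rule exI[of _ "\<lambda>\<kappa>. a * c \<kappa>"])
  qed
qed

section \<open>Density of trigonometric polynomials\<close>

lemma integral_square_add_le:
  fixes f g :: "'x \<Rightarrow> real"
  assumes "f \<in> borel_measurable M" "g \<in> borel_measurable M"
    and "integrable M (\<lambda>x. (f x)\<^sup>2)" "integrable M (\<lambda>x. (g x)\<^sup>2)"
  shows "integrable M (\<lambda>x. (f x + g x)\<^sup>2)"
    and "(LINT x|M. (f x + g x)\<^sup>2) \<le> 2 * (LINT x|M. (f x)\<^sup>2) + 2 * (LINT x|M. (g x)\<^sup>2)"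
proof -
  show int: "integrable M (\<lambda>x. (f x + g x)\<^sup>2)"
    using add_square_integrable[of f M g] assms by simp
  have "(LINT x|M. (f x + g x)\<^sup>2) \<le> (LINT x|M. 2 * (f x)\<^sup>2 + 2 * (g x)\<^sup>2)"
  proof (rule integral_mono[OF int])
    show "integrable M (\<lambda>x. 2 * (f x)\<^sup>2 + 2 * (g x)\<^sup>2)" using assms by simp
    show "(f x + g x)\<^sup>2 \<le> 2 * (f x)\<^sup>2 + 2 * (g x)\<^sup>2" for x
      using sum_squares_bound[of "f x" "g x"] by (simp add: power2_sum)
  qed
  also have "\<dots> = 2 * (LINT x|M. (f x)\<^sup>2) + 2 * (LINT x|M. (g x)\<^sup>2)" using assms by simp
  finally show "(LINT x|M. (f x + g x)\<^sup>2) \<le> 2 * (LINT x|M. (f x)\<^sup>2) + 2 * (LINT x|M. (g x)\<^sup>2)" .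
qed

lemma real_polynomial_function_measurable:
  fixes p :: "'a::euclidean_space \<Rightarrow> real"
  shows "real_polynomial_function p \<Longrightarrow> p \<in> borel_measurable borel"
  by (intro borel_measurable_continuous_onI continuous_on_polymonial_function)
    (simp add: real_polynomial_function_eq)

text \<open>
  Indicators are approximated by Urysohn functions (inner and outer regularity), these by polynomials
  uniformly on \<open>S\<close> (Stone-Weierstrass); simple functions and dominated convergence give the rest.
\<close>

proposition real_polynomial_function_dense_L2:
  fixes \<mu> :: "'a::euclidean_space measure" and G :: "'a \<Rightarrow> real"
  assumes fin: "finite_measure \<mu>" and sets: "sets \<mu> = sets borel"
    and S: "compact S" "AE x in \<mu>. x \<in> S"
    and G: "G \<in> borel_measurable borel" "integrable \<mu> (\<lambda>x. (G x)\<^sup>2)" and "0 < \<epsilon>"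
  shows "\<exists>p. real_polynomial_function p \<and> (LINT x|\<mu>. (G x - p x)\<^sup>2) < \<epsilon>"
proof -
  interpret finite_measure \<mu> by (rule fin)
  have meas: "measurable \<mu> N = measurable borel N" for N :: "'z measure"
    by (rule measurable_cong_sets[OF sets]) simp
  have [simp]: "space \<mu> = UNIV" using sets_eq_imp_space_eq[OF sets] by simp
  have polyL2: "p \<in> borel_measurable \<mu>" "integrable \<mu> (\<lambda>x. (p x)\<^sup>2)" if p: "real_polynomial_function p" for p
  proof -
    show m: "p \<in> borel_measurable \<mu>" using real_polynomial_function_measurable[OF p] by (simp add: meas)
    have "compact (p ` S)"
      using p by (intro compact_continuous_image S continuous_on_polymonial_function)
        (simp add: real_polynomial_function_eq)
    then obtain B where B: "\<And>x. x \<in> S \<Longrightarrow> norm (p x) \<le> B"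
      by (meson bounded_iff compact_imp_bounded imageI)
    have "AE x in \<mu>. norm ((p x)\<^sup>2) \<le> B\<^sup>2"
      using S(2)
    proof eventually_elim
      case (elim x)
      then show ?case using power_mono[OF B[OF elim] norm_ge_zero, of 2] by simp
    qed
    then show "integrable \<mu> (\<lambda>x. (p x)\<^sup>2)" using m by (intro integrable_const_bound) auto
  qed
  define approx where "approx F \<longleftrightarrow> F \<in> borel_measurable \<mu> \<and> integrable \<mu> (\<lambda>x. (F x)\<^sup>2) \<and>
      (\<forall>\<epsilon>>0. \<exists>p. real_polynomial_function p \<and> (LINT x|\<mu>. (F x - p x)\<^sup>2) < \<epsilon>)" for F
  have diffL2: "integrable \<mu> (\<lambda>x. (F x - F' x)\<^sup>2)"
    "(LINT x|\<mu>. (F x - F'' x)\<^sup>2) \<le> 2 * (LINT x|\<mu>. (F x - F' x)\<^sup>2) + 2 * (LINT x|\<mu>. (F' x - F'' x)\<^sup>2)"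
    if m: "F \<in> borel_measurable \<mu>" "F' \<in> borel_measurable \<mu>" "F'' \<in> borel_measurable \<mu>"
      and i: "integrable \<mu> (\<lambda>x. (F x)\<^sup>2)" "integrable \<mu> (\<lambda>x. (F' x)\<^sup>2)" "integrable \<mu> (\<lambda>x. (F'' x)\<^sup>2)"
    for F F' F'' :: "'a \<Rightarrow> real"
  proof -
    have *: "integrable \<mu> (\<lambda>x. (A x - B x)\<^sup>2)"
      if "A \<in> borel_measurable \<mu>" "B \<in> borel_measurable \<mu>" "integrable \<mu> (\<lambda>x. (A x)\<^sup>2)" "integrable \<mu> (\<lambda>x. (B x)\<^sup>2)"
      for A B :: "'a \<Rightarrow> real"
      using integral_square_add_le(1)[of A \<mu> "\<lambda>x. - B x"] that by simp
    show "integrable \<mu> (\<lambda>x. (F x - F' x)\<^sup>2)" using * m i by blast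
    have "(LINT x|\<mu>. ((F x - F' x) + (F' x - F'' x))\<^sup>2)
      \<le> 2 * (LINT x|\<mu>. (F x - F' x)\<^sup>2) + 2 * (LINT x|\<mu>. (F' x - F'' x)\<^sup>2)"
      by (rule integral_square_add_le(2)) (intro borel_measurable_diff * m i)+
    then show "(LINT x|\<mu>. (F x - F'' x)\<^sup>2)
      \<le> 2 * (LINT x|\<mu>. (F x - F' x)\<^sup>2) + 2 * (LINT x|\<mu>. (F' x - F'' x)\<^sup>2)" by simp
  qed
  have approx_indicator: "approx (indicator A)" if A: "A \<in> sets borel" for A
    unfolding approx_def
  proof (intro conjI allI impI)
    show mA: "(indicator A :: 'a \<Rightarrow> real) \<in> borel_measurable \<mu>"
      using A sets by (intro borel_measurable_indicator) simp
    show iA: "integrable \<mu> (\<lambda>x. (indicator A x :: real)\<^sup>2)"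
      using mA by (intro integrable_const_bound[of _ 1] AE_I2 borel_measurable_power)
        (auto split: split_indicator)
    fix \<epsilon> :: real assume \<epsilon>: "0 < \<epsilon>"
    define m where "m = measure \<mu> UNIV"
    have m0: "0 \<le> m" by (simp add: m_def)
    have Afin: "emeasure \<mu> A < \<infinity>" by (simp add: less_top[symmetric])
    obtain C where C: "C \<subseteq> A" "compact C" "emeasure \<mu> A < emeasure \<mu> C + ennreal (\<epsilon> / 12)"
    proof -
      have "\<exists>C\<in>{K. K \<subseteq> A \<and> compact K}. emeasure \<mu> A < emeasure \<mu> C + ennreal (\<epsilon> / 12)"
        using \<epsilon> Afin by (intro SUP_approx_ennreal inner_regular[OF sets _ A]) auto
      then show ?thesis using that by blast
    qed
    obtain U where U: "A \<subseteq> U" "open U" "emeasure \<mu> U < emeasure \<mu> A + ennreal (\<epsilon> / 12)"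
    proof -
      have "\<exists>U\<in>{U. A \<subseteq> U \<and> open U}. emeasure \<mu> U < emeasure \<mu> A + ennreal (\<epsilon> / 12)"
        using \<epsilon> Afin by (intro INF_approx_ennreal outer_regular[OF sets _ A]) auto
      then show ?thesis using that by blast
    qed
    have Cs: "C \<in> sets \<mu>" and Us: "U \<in> sets \<mu>"
      using C(2) U(2) sets by (auto simp: borel_compact)
    have "measure \<mu> A < measure \<mu> C + \<epsilon> / 12" "measure \<mu> U < measure \<mu> A + \<epsilon> / 12"
      using C(3) U(3) \<epsilon> by (simp_all add: emeasure_eq_measure ennreal_less_iff flip: ennreal_plus)
    then have small: "measure \<mu> (U - C) < \<epsilon> / 6"
      using finite_measure_Diff[OF Us Cs] C U by auto
    obtain \<phi> :: "'a \<Rightarrow> real" where \<phi>: "continuous_on UNIV \<phi>" "\<And>x. \<phi> x \<in> closed_segment 0 1"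
        "\<And>x. x \<in> - U \<Longrightarrow> \<phi> x = 0" "\<And>x. x \<in> C \<Longrightarrow> \<phi> x = 1"
      using Urysohn_local[of UNIV "- U" C 0 1] C U compact_imp_closed[OF C(2)] by (auto simp: closed_Compl)
    have \<phi>01: "0 \<le> \<phi> x" "\<phi> x \<le> 1" for x using \<phi>(2)[of x] by (auto simp: closed_segment_eq_real_ivl)
    have m\<phi>: "\<phi> \<in> borel_measurable \<mu>" using borel_measurable_continuous_onI[OF \<phi>(1)] by (simp add: meas)
    have i\<phi>: "integrable \<mu> (\<lambda>x. (\<phi> x)\<^sup>2)"
      using m\<phi> by (intro integrable_const_bound[of _ 1]) (auto simp: \<phi>01 power_le_one)
    have pos: "0 < \<epsilon> / (6 * (m + 1))" using \<epsilon> m0 by simp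
    define \<delta> where "\<delta> = sqrt (\<epsilon> / (6 * (m + 1)))"
    have \<delta>: "0 < \<delta>" "\<delta>\<^sup>2 = \<epsilon> / (6 * (m + 1))" using pos by (simp_all add: \<delta>_def)
    obtain p where p: "real_polynomial_function p" "\<And>x. x \<in> S \<Longrightarrow> \<bar>\<phi> x - p x\<bar> < \<delta>"
      using Stone_Weierstrass_real_polynomial_function[OF S(1) continuous_on_subset[OF \<phi>(1)] \<delta>(1)] by auto
    have "(LINT x|\<mu>. (indicator A x - \<phi> x)\<^sup>2) \<le> (LINT x|\<mu>. indicator (U - C) x)"
    proof (rule integral_mono)
      show "integrable \<mu> (\<lambda>x. (indicator A x - \<phi> x)\<^sup>2)" by (rule diffL2(1)[OF mA m\<phi> m\<phi> iA i\<phi> i\<phi>])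
      show "integrable \<mu> (indicator (U - C) :: 'a \<Rightarrow> real)"
        using Us Cs by (intro integrable_real_indicator) (auto simp: less_top[symmetric])
      show "(indicator A x - \<phi> x)\<^sup>2 \<le> indicator (U - C) x" for x
      proof (cases "x \<in> U - C")
        case True
        have "\<bar>indicator A x - \<phi> x\<bar> \<le> 1" using \<phi>01[of x] by (auto simp: indicator_def)
        then have "(indicator A x - \<phi> x)\<^sup>2 \<le> 1" by (simp add: abs_square_le_1)
        then show ?thesis using True by simp
      next
        case False
        then show ?thesis using \<phi>(3,4) C(1) U(1) by (auto simp: indicator_def)
      qed
    qed
    also have "\<dots> < \<epsilon> / 6" using small Us Cs by simp
    finally have 1: "(LINT x|\<mu>. (indicator A x - \<phi> x)\<^sup>2) < \<epsilon> / 6" .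
    have "(LINT x|\<mu>. (\<phi> x - p x)\<^sup>2) \<le> (LINT x|\<mu>. \<delta>\<^sup>2)"
    proof (rule integral_mono_AE)
      show "integrable \<mu> (\<lambda>x. (\<phi> x - p x)\<^sup>2)" using diffL2(1)[OF m\<phi> _ m\<phi> i\<phi> _ i\<phi>] polyL2[OF p(1)] by blast
      show "AE x in \<mu>. (\<phi> x - p x)\<^sup>2 \<le> \<delta>\<^sup>2"
        using S(2)
      proof eventually_elim
        case (elim x)
        have "\<bar>\<phi> x - p x\<bar> \<le> \<bar>\<delta>\<bar>" using p(2)[OF elim] by simp
        then show ?case by (simp only: abs_le_square_iff)
      qed
    qed simp
    also have "\<dots> = m * (\<epsilon> / (6 * (m + 1)))" by (simp add: m_def \<delta>(2))
    also have "\<dots> \<le> \<epsilon> / 6" using \<epsilon> m0 by (simp add: field_simps)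
    finally have 2: "(LINT x|\<mu>. (\<phi> x - p x)\<^sup>2) \<le> \<epsilon> / 6" .
    have "(LINT x|\<mu>. (indicator A x - p x)\<^sup>2)
      \<le> 2 * (LINT x|\<mu>. (indicator A x - \<phi> x)\<^sup>2) + 2 * (LINT x|\<mu>. (\<phi> x - p x)\<^sup>2)"
      using polyL2[OF p(1)] by (intro diffL2(2) mA m\<phi> iA i\<phi>)
    with 1 2 \<epsilon> have "(LINT x|\<mu>. (indicator A x - p x)\<^sup>2) < \<epsilon>" by linarith
    with p(1) show "\<exists>p. real_polynomial_function p \<and> (LINT x|\<mu>. (indicator A x - p x)\<^sup>2) < \<epsilon>" by blast
  qed
  have approx_scale: "approx (\<lambda>x. c * F x)" if F: "approx F" for F c
    unfolding approx_def
  proof (intro conjI allI impI)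
    have m: "F \<in> borel_measurable \<mu>" "integrable \<mu> (\<lambda>x. (F x)\<^sup>2)" using F by (auto simp: approx_def)
    show "(\<lambda>x. c * F x) \<in> borel_measurable \<mu>" using m by simp
    show "integrable \<mu> (\<lambda>x. (c * F x)\<^sup>2)" using m by (simp add: power_mult_distrib)
    fix \<epsilon> :: real assume \<epsilon>: "0 < \<epsilon>"
    have "0 < \<epsilon> / (c\<^sup>2 + 1)" using \<epsilon> by (intro divide_pos_pos) (auto simp: add_nonneg_pos)
    then obtain p where p: "real_polynomial_function p" "(LINT x|\<mu>. (F x - p x)\<^sup>2) < \<epsilon> / (c\<^sup>2 + 1)"
      using F by (auto simp: approx_def)
    have "(LINT x|\<mu>. (c * F x - c * p x)\<^sup>2) = c\<^sup>2 * (LINT x|\<mu>. (F x - p x)\<^sup>2)"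
      by (simp add: power_mult_distrib flip: right_diff_distrib)
    also have "\<dots> \<le> (c\<^sup>2 + 1) * (LINT x|\<mu>. (F x - p x)\<^sup>2)"
      by (intro mult_right_mono) auto
    also have "\<dots> < \<epsilon>" using p(2) by (simp add: pos_less_divide_eq add_nonneg_pos mult.commute)
    finally show "\<exists>p. real_polynomial_function p \<and> (LINT x|\<mu>. (c * F x - p x)\<^sup>2) < \<epsilon>"
      using p(1) by (intro exI[of _ "\<lambda>x. c * p x"]) auto
  qed
  have approx_add: "approx (\<lambda>x. F x + F' x)" if F: "approx F" "approx F'" for F F'
    unfolding approx_def
  proof (intro conjI allI impI)
    have m: "F \<in> borel_measurable \<mu>" "integrable \<mu> (\<lambda>x. (F x)\<^sup>2)"
        "F' \<in> borel_measurable \<mu>" "integrable \<mu> (\<lambda>x. (F' x)\<^sup>2)" using F by (auto simp: approx_def)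
    show "(\<lambda>x. F x + F' x) \<in> borel_measurable \<mu>" using m by simp
    show "integrable \<mu> (\<lambda>x. (F x + F' x)\<^sup>2)" using integral_square_add_le(1) m by blast
    fix \<epsilon> :: real assume \<epsilon>: "0 < \<epsilon>"
    then have \<epsilon>4: "0 < \<epsilon> / 4" by simp
    obtain p where p: "real_polynomial_function p" "(LINT x|\<mu>. (F x - p x)\<^sup>2) < \<epsilon> / 4"
      using F(1) \<epsilon>4 unfolding approx_def by blast
    obtain q where q: "real_polynomial_function q" "(LINT x|\<mu>. (F' x - q x)\<^sup>2) < \<epsilon> / 4"
      using F(2) \<epsilon>4 unfolding approx_def by blast
    have "(LINT x|\<mu>. ((F x - p x) + (F' x - q x))\<^sup>2)
        \<le> 2 * (LINT x|\<mu>. (F x - p x)\<^sup>2) + 2 * (LINT x|\<mu>. (F' x - q x)\<^sup>2)"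
      by (intro integral_square_add_le(2) borel_measurable_diff diffL2(1)[of _ _ F] m polyL2[OF p(1)] polyL2[OF q(1)])
    also have "\<dots> < \<epsilon>" using p q by linarith
    finally have "(LINT x|\<mu>. (F x + F' x - (p x + q x))\<^sup>2) < \<epsilon>" by (simp add: algebra_simps)
    then show "\<exists>p. real_polynomial_function p \<and> (LINT x|\<mu>. (F x + F' x - p x)\<^sup>2) < \<epsilon>"
      using p(1) q(1) by (intro exI[of _ "\<lambda>x. p x + q x"]) auto
  qed
  have approx_sum: "approx (\<lambda>x. \<Sum>k\<in>I. F k x)" if "finite I" "\<And>k. k \<in> I \<Longrightarrow> approx (F k)"
    for I :: "real set" and F
    using that
  proof (induction I rule: finite_induct)
    case empty
    show ?case using approx_scale[OF approx_indicator[of "{}"], of 0] by simp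
  next
    case (insert k I)
    then show ?case using approx_add[of "F k" "\<lambda>x. \<Sum>k\<in>I. F k x"] by simp
  qed
  have GL2: "G \<in> borel_measurable \<mu>" "integrable \<mu> (\<lambda>x. (G x)\<^sup>2)" using G by (simp_all add: meas)
  obtain s where s: "\<And>i. simple_function \<mu> (s i)" "\<And>x. (\<lambda>i. s i x) \<longlonglongrightarrow> G x"
      "\<And>i x. norm (s i x) \<le> 2 * norm (G x)"
    using borel_measurable_implies_sequence_metric[OF GL2(1), of 0] unfolding dist_0_norm dist_norm
    by (simp add: Ball_def) metis
  have approx_s: "approx (s i)" for i
  proof -
    have "s i = (\<lambda>x. \<Sum>y\<in>range (s i). y * indicator (s i -` {y}) x)"
    proof
      fix x
      have "(\<Sum>y\<in>range (s i). y * indicator (s i -` {y}) x) = (\<Sum>y\<in>range (s i). if y = s i x then y else 0)"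
        by (intro sum.cong) (auto simp: indicator_def)
      then show "s i x = (\<Sum>y\<in>range (s i). y * indicator (s i -` {y}) x)"
        using simple_functionD(1)[OF s(1)[of i]] by simp
    qed
    moreover have "approx (\<lambda>x. \<Sum>y\<in>range (s i). y * indicator (s i -` {y}) x)"
    proof (intro approx_sum approx_scale approx_indicator)
      show "finite (range (s i))" using simple_functionD(1)[OF s(1)[of i]] by simp
      show "s i -` {y} \<in> sets borel" for y using simple_functionD(2)[OF s(1)[of i], of "{y}"] sets by simp
    qed
    ultimately show ?thesis by simp
  qed
  have "(\<lambda>i. LINT x|\<mu>. (G x - s i x)\<^sup>2) \<longlonglongrightarrow> (LINT x|\<mu>. 0)"
  proof (rule integral_dominated_convergence[where w="\<lambda>x. 9 * (G x)\<^sup>2"])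
    show "(\<lambda>x. (G x - s i x)\<^sup>2) \<in> borel_measurable \<mu>" for i
      using GL2 borel_measurable_simple_function[OF s(1)[of i]] by simp
    show "AE x in \<mu>. (\<lambda>i. (G x - s i x)\<^sup>2) \<longlonglongrightarrow> 0"
    proof (rule AE_I2)
      fix x
      have "(\<lambda>i. (G x - s i x)\<^sup>2) \<longlonglongrightarrow> (G x - G x)\<^sup>2"
        by (intro tendsto_power tendsto_diff tendsto_const s(2))
      then show "(\<lambda>i. (G x - s i x)\<^sup>2) \<longlonglongrightarrow> 0" by simp
    qed
    show "AE x in \<mu>. norm ((G x - s i x)\<^sup>2) \<le> 9 * (G x)\<^sup>2" for i
    proof (rule AE_I2)
      fix x
      have "\<bar>G x - s i x\<bar> \<le> \<bar>3 * G x\<bar>" using s(3)[of i x] by (simp add: abs_if split: if_splits)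
      then have "(G x - s i x)\<^sup>2 \<le> (3 * G x)\<^sup>2" by (simp only: abs_le_square_iff)
      then show "norm ((G x - s i x)\<^sup>2) \<le> 9 * (G x)\<^sup>2" by (simp add: power_mult_distrib)
    qed
  qed (use GL2 in auto)
  then have "eventually (\<lambda>i. (LINT x|\<mu>. (G x - s i x)\<^sup>2) < \<epsilon> / 4) sequentially"
    using \<open>0 < \<epsilon>\<close> by (intro order_tendstoD(2)[of _ 0]) auto
  then obtain i where i: "(LINT x|\<mu>. (G x - s i x)\<^sup>2) < \<epsilon> / 4" by (auto simp: eventually_sequentially)
  have "0 < \<epsilon> / 4" using \<open>0 < \<epsilon>\<close> by simp
  then obtain p where p: "real_polynomial_function p" "(LINT x|\<mu>. (s i x - p x)\<^sup>2) < \<epsilon> / 4"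
    using approx_s[of i] unfolding approx_def by blast
  have "(LINT x|\<mu>. (G x - p x)\<^sup>2) \<le> 2 * (LINT x|\<mu>. (G x - s i x)\<^sup>2) + 2 * (LINT x|\<mu>. (s i x - p x)\<^sup>2)"
    using approx_s[of i] unfolding approx_def by (intro diffL2(2) GL2 polyL2[OF p(1)]) auto
  with i p(2) have "(LINT x|\<mu>. (G x - p x)\<^sup>2) < \<epsilon>" by linarith
  with p(1) show ?thesis by blast
qed

text \<open>
  The torus is embedded into a product of unit circles, where trigonometric polynomials become
  polynomials. The chart inverts the embedding on the unit cube and is only Borel measurable, which
  suffices because functions in \<open>L\<^sup>2\<close> are transported by it.
\<close>

definition torus_embedding :: "real^'d::finite \<Rightarrow> complex^'d" where
  "torus_embedding z = (\<chi> j. cis (2 * pi * z $ j))"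

definition torus_chart :: "complex^'d::finite \<Rightarrow> real^'d" where
  "torus_chart w = (\<Sum>j\<in>UNIV. (Arg2pi (w $ j) / (2 * pi)) *\<^sub>R axis j 1)"

lemma torus_embedding_measurable [measurable]: "torus_embedding \<in> borel_measurable borel"
proof -
  have "continuous_on UNIV (\<lambda>z::real^'d. \<chi> j. cis (2 * pi * z $ j))"
    unfolding cis.ctr by (intro continuous_intros)
  then show ?thesis unfolding torus_embedding_def[abs_def] by (rule borel_measurable_continuous_onI)
qed

lemma torus_chart_measurable [measurable]: "torus_chart \<in> borel_measurable borel"
proof -
  have [measurable]: "Arg2pi \<in> borel_measurable borel"
    unfolding borel_measurable_iff_greater by (simp add: open_Arg2pi2pi_gt borel_open)
  have [measurable]: "(\<lambda>w::complex^'d. w $ j) \<in> borel_measurable borel" for j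
    by (intro borel_measurable_continuous_onI continuous_intros)
  show ?thesis unfolding torus_chart_def[abs_def] by measurable
qed

lemma torus_chart_embedding:
  assumes "z \<in> unit_cube"
  shows "torus_chart (torus_embedding z) = z"
proof -
  have "Arg2pi (cis (2 * pi * z $ j)) / (2 * pi) = z $ j" for j
  proof -
    have "0 \<le> z \<bullet> axis j 1 \<and> z \<bullet> axis j 1 < 1"
      using assms by (auto simp: unit_cube_def axis_in_Basis_iff)
    then have "0 \<le> z $ j" "z $ j < 1" by (simp_all add: inner_axis)
    then have "Arg2pi (cis (2 * pi * z $ j)) = 2 * pi * z $ j"
      by (intro Arg2pi_unique[of 1]) (simp_all add: cis_conv_exp)
    then show ?thesis by simp
  qed
  then show ?thesis
    by (simp add: torus_chart_def torus_embedding_def vec_eq_iff axis_def if_distrib cong: if_cong)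
qed

lemma trig_poly_coordinate:
  "trig_poly (\<lambda>z::real^'d::finite. cos (2 * pi * z $ j))" "trig_poly (\<lambda>z::real^'d::finite. sin (2 * pi * z $ j))"
proof -
  have w: "wave (\<lambda>i. if i = j then k else 0) z = cas k (z $ j)" for k and z :: "real^'d"
  proof -
    have "wave (\<lambda>i. if i = j then k else 0) z = (\<Prod>i\<in>UNIV. if i = j then cas k (z $ i) else 1)"
      unfolding wave_def by (intro prod.cong) auto
    then show ?thesis by simp
  qed
  have t: "trig_poly (\<lambda>z::real^'d. cas k (z $ j))" for k
    using trig_poly.wave[of "\<lambda>i. if i = j then k else 0"] unfolding w[symmetric] .
  have "trig_poly (\<lambda>z::real^'d. 1/2 * cas 1 (z $ j) + 1/2 * cas (- 1) (z $ j))"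
    "trig_poly (\<lambda>z::real^'d. 1/2 * cas 1 (z $ j) + (- 1/2) * cas (- 1) (z $ j))"
    by (intro trig_poly.add trig_poly.scale t)+
  then show "trig_poly (\<lambda>z::real^'d. cos (2 * pi * z $ j))" "trig_poly (\<lambda>z::real^'d. sin (2 * pi * z $ j))"
    by (simp_all add: cas_def field_simps)
qed

lemma trig_poly_real_polynomial_function:
  fixes p :: "complex^'d::finite \<Rightarrow> real"
  shows "real_polynomial_function p \<Longrightarrow> trig_poly (\<lambda>z. p (torus_embedding z))"
proof (induction p rule: real_polynomial_function.induct)
  case (linear f)
  have "f (torus_embedding z) = (\<Sum>j\<in>UNIV. f (axis j 1) * cos (2 * pi * z $ j) + f (axis j \<i>) * sin (2 * pi * z $ j))" for z
  proof -
    have "torus_embedding z = (\<Sum>j\<in>UNIV. cos (2 * pi * z $ j) *\<^sub>R axis j 1 + sin (2 * pi * z $ j) *\<^sub>R axis j \<i>)"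
      by (simp add: torus_embedding_def vec_eq_iff axis_def complex_eq_iff if_distrib sum.distrib cong: if_cong)
    then show ?thesis
      using bounded_linear.linear[OF linear]
      by (simp add: linear_sum linear_add linear_cmul mult.commute)
  qed
  then show ?case by (simp add: trig_poly_sum trig_poly.add trig_poly.scale trig_poly_coordinate)
next
  case (const c)
  show ?case by (rule trig_poly_const)
next
  case (add f g)
  then show ?case by (intro trig_poly.add)
next
  case (mult f g)
  then show ?case by (intro trig_poly_mult)
qed

proposition trig_poly_dense_L2:
  fixes G :: "real^'d::finite \<Rightarrow> real"
  assumes G: "G \<in> torus_L2" and "0 < \<epsilon>"
  shows "\<exists>p. trig_poly p \<and> (LINT z|torus. (G z - p z)\<^sup>2) < \<epsilon>"
proof -
  have [measurable]: "G \<in> borel_measurable borel" and iG: "integrable torus (\<lambda>z. (G z)\<^sup>2)"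
    using G by (auto simp: torus_L2_def)
  define \<mu> where "\<mu> = distr torus borel (torus_embedding :: real^'d \<Rightarrow> complex^'d)"
  define S where "S = {w :: complex^'d. \<forall>j. norm (w $ j) = 1}"
  let ?G = "\<lambda>w. G (torus_chart w)"
  have eqG: "AE z in torus. ?G (torus_embedding z) = G z"
    using torus_AE_unit_cube by eventually_elim (simp add: torus_chart_embedding)
  have "\<exists>p. real_polynomial_function p \<and> (LINT w|\<mu>. (?G w - p w)\<^sup>2) < \<epsilon>"
  proof (rule real_polynomial_function_dense_L2[of _ S])
    show "finite_measure \<mu>" unfolding \<mu>_def by (intro torus.finite_measure_distr) simp
    show "sets \<mu> = sets borel" by (simp add: \<mu>_def)
    have "closed S" unfolding S_def by (intro closed_Collect_all closed_Collect_eq continuous_intros)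
    moreover have "bounded S"
    proof (rule boundedI)
      fix w assume "w \<in> S"
      then have "(\<Sum>j\<in>UNIV. norm (w $ j)) = CARD('d)" by (simp add: S_def)
      then show "norm w \<le> CARD('d)"
        using L2_set_le_sum[of UNIV "\<lambda>j. norm (w $ j)"] by (simp add: norm_vec_def)
    qed
    ultimately show "compact S" by (simp add: compact_eq_bounded_closed)
    show "AE w in \<mu>. w \<in> S"
      unfolding \<mu>_def by (subst AE_distr_iff) (auto simp: S_def torus_embedding_def intro!: borel_closed \<open>closed S\<close>[unfolded S_def])
    show "?G \<in> borel_measurable borel" by measurable
    have "integrable torus (\<lambda>z. (?G (torus_embedding z))\<^sup>2)"
      by (subst integrable_cong_AE[OF _ _ AE_mp[OF eqG AE_I2]]) (use iG in \<open>auto\<close>)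
    then show "integrable \<mu> (\<lambda>w. (?G w)\<^sup>2)" unfolding \<mu>_def by (subst integrable_distr_eq) auto
  qed (rule \<open>0 < \<epsilon>\<close>)
  then obtain p where p: "real_polynomial_function p" "(LINT w|\<mu>. (?G w - p w)\<^sup>2) < \<epsilon>" by blast
  have [measurable]: "p \<in> borel_measurable borel" by (rule real_polynomial_function_measurable[OF p(1)])
  have "(LINT w|\<mu>. (?G w - p w)\<^sup>2) = (LINT z|torus. (?G (torus_embedding z) - p (torus_embedding z))\<^sup>2)"
    unfolding \<mu>_def by (subst integral_distr) auto
  also have "\<dots> = (LINT z|torus. (G z - p (torus_embedding z))\<^sup>2)"
    by (rule integral_cong_AE) (use eqG in auto)
  finally show ?thesis using p trig_poly_real_polynomial_function[OF p(1)] by auto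
qed

section \<open>Fourier coefficients and weak gradients\<close>

lemma torus_L2_measurable: "f \<in> torus_L2 \<Longrightarrow> f \<in> borel_measurable torus"
  by (simp add: torus_L2_def)

lemma torus_L2_mult_integrable:
  "f \<in> torus_L2 \<Longrightarrow> g \<in> torus_L2 \<Longrightarrow> integrable torus (\<lambda>z. f z * g z)" for f g :: "'a::euclidean_space \<Rightarrow> real"
  using torus_L2_inner_integrable[of f g] by simp

interpretation L2: semi_inner_product "torus_L2 :: ('a::euclidean_space \<Rightarrow> real) set" "\<lambda>f g. LINT z|torus. f z * g z"
proof
  show "(\<lambda>x. 0) \<in> (torus_L2 :: ('a \<Rightarrow> real) set)" by (simp add: torus_L2_def torus_periodic_def)
next
  fix f g :: "'a \<Rightarrow> real" assume "f \<in> torus_L2" "g \<in> torus_L2"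
  then show "(\<lambda>x. f x + g x) \<in> torus_L2" by (rule torus_L2_add)
next
  fix f :: "'a \<Rightarrow> real" and c assume "f \<in> torus_L2"
  then show "(\<lambda>x. c * f x) \<in> torus_L2" using torus_L2_scale[of f c] by simp
next
  fix f g :: "'a \<Rightarrow> real" 
  show "(LINT z|torus. f z * g z) = (LINT z|torus. g z * f z)" by (simp add: mult.commute)
next
  fix f g h :: "'a \<Rightarrow> real" assume "f \<in> torus_L2" "g \<in> torus_L2" "h \<in> torus_L2"
  then show "(LINT z|torus. (f z + g z) * h z) = (LINT z|torus. f z * h z) + (LINT z|torus. g z * h z)"
    by (simp add: distrib_right torus_L2_mult_integrable)
next
  fix f h :: "'a \<Rightarrow> real" and c
  show "(LINT z|torus. (c * f z) * h z) = c * (LINT z|torus. f z * h z)" by (simp add: mult.assoc)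
next
  fix f :: "'a \<Rightarrow> real" 
  show "0 \<le> (LINT z|torus. f z * f z)" by simp
qed

lemma wave_smooth: "torus_smooth (wave \<kappa>)"
  by (rule trig_poly_torus_smooth[OF trig_poly.wave])

lemma wave_L2: "wave \<kappa> \<in> torus_L2"
  by (rule torus_smooth_L2(1)[OF wave_smooth])

definition wave_coeff :: "(real^'d::finite \<Rightarrow> real) \<Rightarrow> ('d \<Rightarrow> int) \<Rightarrow> real" where
  "wave_coeff f \<kappa> = (LINT z|torus. f z * wave \<kappa> z)"

definition partial_sum :: "nat \<Rightarrow> (real^'d::finite \<Rightarrow> real) \<Rightarrow> real^'d \<Rightarrow> real" where
  "partial_sum N f z = (\<Sum>\<kappa>\<in>modes N. wave_coeff f \<kappa> * wave \<kappa> z)"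

lemma dist_trig_sum:
  assumes "f \<in> torus_L2"
  shows "(LINT z|torus. (f z - (\<Sum>\<kappa>\<in>modes N. c \<kappa> * wave \<kappa> z))\<^sup>2)
    = (LINT z|torus. (f z)\<^sup>2) - (\<Sum>\<kappa>\<in>modes N. (wave_coeff f \<kappa>)\<^sup>2) + (\<Sum>\<kappa>\<in>modes N. (c \<kappa> - wave_coeff f \<kappa>)\<^sup>2)"
  using L2.dist_linear_combination[of "modes N" wave f c] assms
  by (simp add: wave_L2 wave_orthonormal wave_coeff_def power2_eq_square)

lemma Bessel_inequality:
  assumes "f \<in> torus_L2"
  shows "(\<Sum>\<kappa>\<in>modes N. (wave_coeff f \<kappa>)\<^sup>2) \<le> (LINT z|torus. (f z)\<^sup>2)"
proof -
  have "0 \<le> (LINT z|torus. (f z - (\<Sum>\<kappa>\<in>modes N. wave_coeff f \<kappa> * wave \<kappa> z))\<^sup>2)" by simp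
  then show ?thesis using dist_trig_sum[OF assms, where c="wave_coeff f" and N=N] by simp
qed

text \<open>
  A trigonometric polynomial close to \<open>f\<close> belongs to the span of \<open>modes N\<close> for all large \<open>N\<close>, and the
  partial sum is the best approximation from that span.
\<close>

lemma partial_sum_converges:
  fixes f :: "real^'d::finite \<Rightarrow> real"
  assumes f: "f \<in> torus_L2" and "0 < \<epsilon>"
  shows "\<exists>N0. \<forall>N\<ge>N0. (LINT z|torus. (f z - partial_sum N f z)\<^sup>2) < \<epsilon>"
proof -
  obtain p where p: "trig_poly p" "(LINT z|torus. (f z - p z)\<^sup>2) < \<epsilon>"
    using trig_poly_dense_L2[OF assms] by blast
  obtain N0 where N0: "\<forall>N\<ge>N0. \<exists>c. p = (\<lambda>z. \<Sum>\<kappa>\<in>modes N. c \<kappa> * wave \<kappa> z)"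
    using trig_poly_expansion[OF p(1)] ..
  have "(LINT z|torus. (f z - partial_sum N f z)\<^sup>2) < \<epsilon>" if "N \<ge> N0" for N
  proof -
    have "\<exists>c. p = (\<lambda>z. \<Sum>\<kappa>\<in>modes N. c \<kappa> * wave \<kappa> z)" using N0 that by simp
    then obtain c where c: "p = (\<lambda>z. \<Sum>\<kappa>\<in>modes N. c \<kappa> * wave \<kappa> z)" ..
    have "(LINT z|torus. (f z - partial_sum N f z)\<^sup>2) \<le> (LINT z|torus. (f z - p z)\<^sup>2)"
      unfolding c partial_sum_def dist_trig_sum[OF f] by (simp add: sum_nonneg)
    with p(2) show ?thesis by linarith
  qed
  then show ?thesis by blast
qed

lemma wave_coeff_eq_0_imp_AE_0:
  fixes f :: "real^'d::finite \<Rightarrow> real"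
  assumes f: "f \<in> torus_L2" and 0: "\<And>\<kappa>. wave_coeff f \<kappa> = 0"
  shows "AE z in torus. f z = 0"
proof -
  have "(LINT z|torus. (f z)\<^sup>2) \<le> 0 + \<epsilon>" if "0 < \<epsilon>" for \<epsilon>
    using partial_sum_converges[OF f that] by (auto simp: partial_sum_def 0 intro: less_imp_le)
  then have "(LINT z|torus. (f z)\<^sup>2) \<le> 0" by (rule field_le_epsilon)
  moreover have "0 \<le> (LINT z|torus. (f z)\<^sup>2)" by simp
  ultimately have "(LINT z|torus. (f z)\<^sup>2) = 0" by linarith
  moreover have "integrable torus (\<lambda>z. (f z)\<^sup>2)" using f by (simp add: torus_L2_real_iff)
  ultimately have "AE z in torus. (f z)\<^sup>2 = 0" by (subst (asm) integral_nonneg_eq_0_iff_AE) auto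
  then show ?thesis by simp
qed

lemma torus_L2_component:
  fixes G :: "real^'d::finite \<Rightarrow> real^'d"
  assumes "G \<in> torus_L2"
  shows "(\<lambda>z. G z $ j) \<in> torus_L2"
proof -
  have [measurable]: "G \<in> borel_measurable borel" using assms by (simp add: torus_L2_def)
  have m: "(\<lambda>z. G z $ j) \<in> borel_measurable borel"
    using borel_measurable_inner[of G borel "\<lambda>_. axis j 1"] by (simp add: inner_axis)
  have "integrable torus (\<lambda>z. (G z $ j)\<^sup>2)"
  proof (rule Bochner_Integration.integrable_bound[of _ "\<lambda>z. (norm (G z))\<^sup>2"])
    show "AE z in torus. norm ((G z $ j)\<^sup>2) \<le> norm ((norm (G z))\<^sup>2)"
      using component_le_norm_cart[of "G _" j] by (intro AE_I2) (simp add: abs_le_square_iff[symmetric])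
  qed (use assms m in \<open>auto simp: torus_L2_def\<close>)
  then show ?thesis using assms m by (auto simp: torus_L2_def torus_periodic_def)
qed

lemma integral_norm_square_vec:
  fixes G :: "real^'d::finite \<Rightarrow> real^'d"
  assumes "G \<in> torus_L2"
  shows "(LINT z|torus. (norm (G z))\<^sup>2) = (\<Sum>j\<in>UNIV. LINT z|torus. (G z $ j)\<^sup>2)"
proof -
  have "(norm x)\<^sup>2 = (\<Sum>j\<in>UNIV. (x $ j)\<^sup>2)" for x :: "real^'d"
    unfolding power2_norm_eq_inner by (simp add: inner_vec_def power2_eq_square)
  then show ?thesis
    using torus_L2_component[OF assms] by (simp add: torus_L2_real_iff)
qed

text \<open>
  The definition of the weak gradient tested with the wave itself. It determines the weak gradient
  up to null sets and shows that partial sums commute with it.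
\<close>

lemma weak_gradient_wave_coeff:
  fixes u :: "real^'d::finite \<Rightarrow> real"
  assumes u: "u \<in> torus_L2" and G: "has_weak_gradient u G"
  shows "wave_coeff (\<lambda>z. G z $ j) \<kappa> = - (2 * pi * of_int (\<kappa> j)) * wave_coeff u (flip_mode \<kappa> j)"
proof -
  have GL2: "G \<in> torus_L2" using G by (simp add: has_weak_gradient_def)
  have comp: "(LINT z|torus. F z) $ j = (LINT z|torus. F z $ j)" if "integrable torus F" for F :: "real^'d \<Rightarrow> real^'d"
    using integral_bounded_linear[OF bounded_linear_vec_nth that] by simp
  have "(LINT z|torus. u z *\<^sub>R gradient (wave \<kappa>) z) = - (LINT z|torus. wave \<kappa> z *\<^sub>R G z)"
    using G wave_smooth[of \<kappa>] unfolding has_weak_gradient_def by blast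
  then have "(LINT z|torus. u z *\<^sub>R gradient (wave \<kappa>) z) $ j = - ((LINT z|torus. wave \<kappa> z *\<^sub>R G z) $ j)"
    by simp
  then have "(LINT z|torus. u z * gradient (wave \<kappa>) z $ j) = - (LINT z|torus. wave \<kappa> z * G z $ j)"
    by (simp add: comp torus_L2_scaleR_integrable[OF u torus_smooth_L2(2)[OF wave_smooth]]
        torus_L2_scaleR_integrable[OF wave_L2 GL2])
  moreover have "(LINT z|torus. u z * gradient (wave \<kappa>) z $ j) = 2 * pi * of_int (\<kappa> j) * wave_coeff u (flip_mode \<kappa> j)"
    unfolding wave_gradient wave_coeff_def by (simp add: mult.left_commute mult.assoc flip: integral_mult_right_zero)
  ultimately show ?thesis by (simp add: wave_coeff_def mult.commute)
qed

lemma weak_gradient_unique: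
  fixes u :: "real^'d::finite \<Rightarrow> real"
  assumes u: "u \<in> torus_L2" and G: "has_weak_gradient u G" "has_weak_gradient u G'"
  shows "AE z in torus. G z = G' z"
proof -
  have L2: "G \<in> torus_L2" "G' \<in> torus_L2" using G by (simp_all add: has_weak_gradient_def)
  have "AE z in torus. G z $ j - G' z $ j = 0" for j
  proof (rule wave_coeff_eq_0_imp_AE_0)
    show "(\<lambda>z. G z $ j - G' z $ j) \<in> torus_L2" by (intro L2.diff_mem torus_L2_component L2)
    show "wave_coeff (\<lambda>z. G z $ j - G' z $ j) \<kappa> = 0" for \<kappa>
      using L2.diff_left[OF torus_L2_component[OF L2(1)] torus_L2_component[OF L2(2)] wave_L2, of j j \<kappa>]
        weak_gradient_wave_coeff[OF u G(1), of j \<kappa>] weak_gradient_wave_coeff[OF u G(2), of j \<kappa>]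
      by (simp add: wave_coeff_def)
  qed
  then have "AE z in torus. \<forall>j. G z $ j - G' z $ j = 0" by (simp add: AE_all_countable)
  then show ?thesis by eventually_elim (simp add: vec_eq_iff)
qed

lemma has_weak_gradient_add:
  fixes f g :: "'a::euclidean_space \<Rightarrow> real"
  assumes f: "f \<in> torus_L2" "has_weak_gradient f F" and g: "g \<in> torus_L2" "has_weak_gradient g G"
  shows "has_weak_gradient (\<lambda>x. f x + g x) (\<lambda>x. F x + G x)"
  unfolding has_weak_gradient_def
proof (intro conjI allI impI)
  have L2: "F \<in> torus_L2" "G \<in> torus_L2" using f g by (auto simp: has_weak_gradient_def)
  show "(\<lambda>x. F x + G x) \<in> torus_L2" using L2 by (rule torus_L2_add)
  fix \<phi> :: "'a \<Rightarrow> real" assume \<phi>: "torus_smooth \<phi>"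
  note [simp] = torus_L2_scaleR_integrable[OF f(1) torus_smooth_L2(2)[OF \<phi>]]
    torus_L2_scaleR_integrable[OF g(1) torus_smooth_L2(2)[OF \<phi>]]
    torus_L2_scaleR_integrable[OF torus_smooth_L2(1)[OF \<phi>] L2(1)]
    torus_L2_scaleR_integrable[OF torus_smooth_L2(1)[OF \<phi>] L2(2)]
  show "(LINT x|torus. (f x + g x) *\<^sub>R gradient \<phi> x) = - (LINT x|torus. \<phi> x *\<^sub>R (F x + G x))"
    using f(2) g(2) \<phi> by (simp add: has_weak_gradient_def scaleR_add_left scaleR_add_right)
qed

lemma has_weak_gradient_scale:
  fixes f :: "'a::euclidean_space \<Rightarrow> real"
  assumes "has_weak_gradient f F"
  shows "has_weak_gradient (\<lambda>x. c * f x) (\<lambda>x. c *\<^sub>R F x)"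
  unfolding has_weak_gradient_def
proof (intro conjI allI impI)
  show "(\<lambda>x. c *\<^sub>R F x) \<in> torus_L2" using assms by (intro torus_L2_scale) (simp add: has_weak_gradient_def)
  fix \<phi> :: "'a \<Rightarrow> real" assume "torus_smooth \<phi>"
  then have *: "(LINT x|torus. f x *\<^sub>R gradient \<phi> x) = - (LINT x|torus. \<phi> x *\<^sub>R F x)"
    using assms by (simp add: has_weak_gradient_def)
  have "(LINT x|torus. (c * f x) *\<^sub>R gradient \<phi> x) = c *\<^sub>R (LINT x|torus. f x *\<^sub>R gradient \<phi> x)"
    by (simp flip: scaleR_scaleR)
  moreover have "(LINT x|torus. \<phi> x *\<^sub>R (c *\<^sub>R F x)) = c *\<^sub>R (LINT x|torus. \<phi> x *\<^sub>R F x)"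
    by (simp only: scaleR_left_commute[of _ c] integral_scaleR_right)
  ultimately show "(LINT x|torus. (c * f x) *\<^sub>R gradient \<phi> x) = - (LINT x|torus. \<phi> x *\<^sub>R (c *\<^sub>R F x))"
    by (simp add: *)
qed

lemma torus_H1_D:
  assumes "f \<in> torus_H1"
  shows "f \<in> torus_L2" "has_weak_gradient f (weak_gradient f)" "weak_gradient f \<in> torus_L2"
proof -
  show "f \<in> torus_L2" using assms by (simp add: torus_H1_def)
  show *: "has_weak_gradient f (weak_gradient f)"
    unfolding weak_gradient_def using assms by (intro someI_ex[of "has_weak_gradient f"]) (simp add: torus_H1_def)
  then show "weak_gradient f \<in> torus_L2" by (simp add: has_weak_gradient_def)
qed

lemma torus_H1_I: "f \<in> torus_L2 \<Longrightarrow> has_weak_gradient f G \<Longrightarrow> f \<in> torus_H1"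
  by (auto simp: torus_H1_def)

lemma torus_smooth_H1: "torus_smooth \<phi> \<Longrightarrow> \<phi> \<in> torus_H1"
  by (rule torus_H1_I[OF torus_smooth_L2(1) torus_smooth_has_weak_gradient])

lemma torus_H1_add: "f \<in> torus_H1 \<Longrightarrow> g \<in> torus_H1 \<Longrightarrow> (\<lambda>x. f x + g x) \<in> torus_H1"
  by (rule torus_H1_I[OF torus_L2_add has_weak_gradient_add]) (auto intro: torus_H1_D)

lemma torus_H1_scale: "f \<in> torus_H1 \<Longrightarrow> (\<lambda>x. c * f x) \<in> torus_H1"
  by (rule torus_H1_I[OF L2.scale_mem has_weak_gradient_scale]) (auto intro: torus_H1_D)

lemma weak_gradient_AE_eq:
  fixes f :: "real^'d::finite \<Rightarrow> real"
  assumes "f \<in> torus_L2" "has_weak_gradient f G"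
  shows "AE z in torus. weak_gradient f z = G z"
  using weak_gradient_unique[OF assms(1) torus_H1_D(2)[OF torus_H1_I[OF assms]] assms(2)] .

lemma weak_gradient_add:
  fixes f g :: "real^'d::finite \<Rightarrow> real"
  assumes "f \<in> torus_H1" "g \<in> torus_H1"
  shows "AE z in torus. weak_gradient (\<lambda>x. f x + g x) z = weak_gradient f z + weak_gradient g z"
  using torus_H1_D[OF assms(1)] torus_H1_D[OF assms(2)]
  by (intro weak_gradient_AE_eq torus_L2_add has_weak_gradient_add)

lemma weak_gradient_scale:
  fixes f :: "real^'d::finite \<Rightarrow> real"
  assumes "f \<in> torus_H1"
  shows "AE z in torus. weak_gradient (\<lambda>x. c * f x) z = c *\<^sub>R weak_gradient f z"
  using torus_H1_D[OF assms] by (intro weak_gradient_AE_eq L2.scale_mem has_weak_gradient_scale)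

lemma torus_L2_integrable: "f \<in> torus_L2 \<Longrightarrow> integrable torus f" for f :: "'a::euclidean_space \<Rightarrow> real"
  using torus_L2_mult_integrable[of f "\<lambda>_. 1"] by (simp add: torus_L2_def torus_periodic_def)

lemma H_space_D: "f \<in> H_space \<Longrightarrow> f \<in> torus_H1"
  by (simp add: H_space_def)

lemma H_space_add: "f \<in> H_space \<Longrightarrow> g \<in> H_space \<Longrightarrow> (\<lambda>x. f x + g x) \<in> H_space"
  by (simp add: H_space_def torus_H1_add torus_L2_integrable[OF torus_H1_D(1)])

lemma H_space_scale: "f \<in> H_space \<Longrightarrow> (\<lambda>x. c * f x) \<in> H_space"
  by (simp add: H_space_def torus_H1_scale)

lemma wave_in_Sigma_space:
  fixes \<kappa> :: "'d::finite \<Rightarrow> int"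
  assumes "\<kappa> i \<noteq> 0"
  shows "wave \<kappa> \<in> Sigma_space i"
proof -
  have "\<kappa> \<noteq> (\<lambda>_. 0)" using assms by auto
  then have "wave \<kappa> \<in> H_space"
    by (simp add: H_space_def torus_smooth_H1 wave_smooth torus_integral_wave)
  then show ?thesis
    unfolding Sigma_space_def using assms
    by (auto intro!: exI[of _ "\<lambda>j. cas (\<kappa> j)"] torus_smooth_H1 cas_torus_smooth torus_integral_cas simp: wave_def)
qed

lemma Sigma_space_scale:
  fixes g :: "real^'d::finite \<Rightarrow> real"
  assumes "g \<in> Sigma_space i"
  shows "(\<lambda>z. c * g z) \<in> Sigma_space i"
proof -
  obtain r where r: "\<And>j. r j \<in> torus_H1" "(LINT t|torus. r i t) = 0"
      "AE z in torus. g z = (\<Prod>j\<in>UNIV. r j (z $ j))" and g: "g \<in> H_space"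
    using assms by (auto simp: Sigma_space_def)
  define r' where "r' = r(i := (\<lambda>t. c * r i t))"
  have prod: "(\<Prod>j\<in>UNIV. r' j (z $ j)) = c * (\<Prod>j\<in>UNIV. r j (z $ j))" for z :: "real^'d"
  proof -
    have "(\<Prod>j\<in>UNIV. r' j (z $ j)) = r' i (z $ i) * (\<Prod>j\<in>UNIV - {i}. r' j (z $ j))"
      by (subst prod.remove[of UNIV i]) auto
    also have "(\<Prod>j\<in>UNIV - {i}. r' j (z $ j)) = (\<Prod>j\<in>UNIV - {i}. r j (z $ j))"
      by (intro prod.cong) (auto simp: r'_def)
    also have "r' i (z $ i) * \<dots> = c * (r i (z $ i) * \<dots>)" by (simp add: r'_def)
    also have "r i (z $ i) * (\<Prod>j\<in>UNIV - {i}. r j (z $ j)) = (\<Prod>j\<in>UNIV. r j (z $ j))"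
      by (rule prod.remove[symmetric]) auto
    finally show ?thesis .
  qed
  have "\<forall>j. r' j \<in> torus_H1" using r(1) by (simp add: r'_def torus_H1_scale)
  moreover have "(LINT t|torus. r' i t) = 0" using r(2) by (simp add: r'_def)
  moreover have "AE z in torus. c * g z = (\<Prod>j\<in>UNIV. r' j (z $ j))"
    using r(3) by eventually_elim (simp add: prod)
  ultimately show ?thesis using H_space_scale[OF g] unfolding Sigma_space_def by blast
qed

lemma wave_coeff_0_H_space: "u \<in> H_space \<Longrightarrow> wave_coeff u (\<lambda>_. 0) = 0"
  by (simp add: wave_coeff_def wave_def H_space_def)

text \<open>
  The gradient of the partial sum of \<open>u\<close> is componentwise the partial sum of the weak gradient of \<open>u\<close>, so it
  converges in \<open>L\<^sup>2\<close>. Since \<open>u\<close> has mean zero, the constant mode drops out, and each other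
  mode is in \<open>Sigma_space i\<close> for every \<open>i\<close> in which its frequency is nonzero.
\<close>

proposition Sigma_space_dense:
  fixes u :: "real^'d::finite \<Rightarrow> real"
  assumes u: "u \<in> H_space" and "0 < \<epsilon>"
  shows "\<exists>(I :: ('d \<Rightarrow> int) set) h. finite I \<and> (\<forall>k\<in>I. h k \<in> (\<Union>i. Sigma_space i)) \<and>
    (LINT z|torus. (norm (weak_gradient (\<lambda>z. u z - (\<Sum>k\<in>I. h k z)) z))\<^sup>2) < \<epsilon>"
proof -
  define G where "G = weak_gradient u"
  have uH1: "u \<in> torus_H1" using u by (rule H_space_D)
  note uL2 = torus_H1_D(1)[OF uH1] and uG = torus_H1_D(2)[OF uH1, folded G_def]
    and GL2 = torus_H1_D(3)[OF uH1, folded G_def]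
  define d where "d = real CARD('d)"
  have d: "0 < d" by (simp add: d_def)
  have "\<exists>N0. \<forall>N\<ge>N0. (LINT z|torus. (G z $ j - partial_sum N (\<lambda>z. G z $ j) z)\<^sup>2) < \<epsilon> / d" for j
    using \<open>0 < \<epsilon>\<close> d by (intro partial_sum_converges torus_L2_component GL2) simp
  then obtain N0 where N0: "\<And>j N. N \<ge> N0 j \<Longrightarrow> (LINT z|torus. (G z $ j - partial_sum N (\<lambda>z. G z $ j) z)\<^sup>2) < \<epsilon> / d"
    by metis
  define N where "N = Max (range N0)"
  have N: "(LINT z|torus. (G z $ j - partial_sum N (\<lambda>z. G z $ j) z)\<^sup>2) < \<epsilon> / d" for j
    unfolding N_def by (rule N0) simp
  define P where "P = partial_sum N u"
  have Ptrig: "trig_poly P"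
    unfolding P_def partial_sum_def[abs_def] by (intro trig_poly_sum trig_poly.scale trig_poly.wave)
  note Psm = trig_poly_torus_smooth[OF Ptrig]
  have gradP: "gradient P z $ j = partial_sum N (\<lambda>z. G z $ j) z" for z j
  proof -
    have "(P has_derivative (\<lambda>h. \<Sum>\<kappa>\<in>modes N. wave_coeff u \<kappa> * (h \<bullet> gradient (wave \<kappa>) z))) (at z)"
      unfolding P_def partial_sum_def[abs_def]
      by (intro has_derivative_sum has_derivative_mult_right torus_smoothD(5) wave_smooth)
    from has_derivative_unique[OF torus_smoothD(5)[OF Psm] this]
    have "axis j 1 \<bullet> gradient P z = (\<Sum>\<kappa>\<in>modes N. wave_coeff u \<kappa> * (axis j 1 \<bullet> gradient (wave \<kappa>) z))"
      by (rule fun_cong)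
    then have "gradient P z $ j = (\<Sum>\<kappa>\<in>modes N. wave_coeff u \<kappa> * (2 * pi * of_int (\<kappa> j) * wave (flip_mode \<kappa> j) z))"
      by (simp add: inner_axis' wave_gradient)
    also have "\<dots> = (\<Sum>\<kappa>\<in>modes N. wave_coeff u (flip_mode \<kappa> j) * (2 * pi * of_int (- \<kappa> j) * wave \<kappa> z))"
      by (rule sum.reindex_bij_witness[of _ "\<lambda>\<kappa>. flip_mode \<kappa> j" "\<lambda>\<kappa>. flip_mode \<kappa> j"]) simp_all
    also have "\<dots> = partial_sum N (\<lambda>z. G z $ j) z"
      unfolding partial_sum_def weak_gradient_wave_coeff[OF uL2 uG] by (intro sum.cong) simp_all
    finally show ?thesis .
  qed
  have uP: "has_weak_gradient (\<lambda>z. u z - P z) (\<lambda>z. G z - gradient P z)"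
    using has_weak_gradient_add[OF uL2 uG L2.scale_mem[OF torus_smooth_L2(1)[OF Psm], of "- 1"]
        has_weak_gradient_scale[OF torus_smooth_has_weak_gradient[OF Psm]]] by simp
  have AE: "AE z in torus. weak_gradient (\<lambda>z. u z - P z) z = G z - gradient P z"
    by (intro weak_gradient_AE_eq uP L2.diff_mem uL2 torus_smooth_L2(1)[OF Psm])
  have GPL2: "(\<lambda>z. G z - gradient P z) \<in> torus_L2" using uP by (simp add: has_weak_gradient_def)
  have "(LINT z|torus. (norm (weak_gradient (\<lambda>z. u z - P z) z))\<^sup>2) = (LINT z|torus. (norm (G z - gradient P z))\<^sup>2)"
  proof (rule integral_cong_AE)
    have "weak_gradient (\<lambda>z. u z - P z) \<in> torus_L2"
      using uP by (intro torus_H1_D(3) torus_H1_I[OF L2.diff_mem[OF uL2 torus_smooth_L2(1)[OF Psm]]])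
    from torus_L2_measurable[OF this]
    show "(\<lambda>z. (norm (weak_gradient (\<lambda>z. u z - P z) z))\<^sup>2) \<in> borel_measurable torus" by measurable
    from torus_L2_measurable[OF GPL2]
    show "(\<lambda>z. (norm (G z - gradient P z))\<^sup>2) \<in> borel_measurable torus" by measurable
    show "AE z in torus. (norm (weak_gradient (\<lambda>z. u z - P z) z))\<^sup>2 = (norm (G z - gradient P z))\<^sup>2"
      using AE by eventually_elim simp
  qed
  also have "\<dots> = (\<Sum>j\<in>UNIV. LINT z|torus. (G z $ j - partial_sum N (\<lambda>z. G z $ j) z)\<^sup>2)"
    unfolding integral_norm_square_vec[OF GPL2] by (simp add: gradP)
  also have "\<dots> < (\<Sum>j\<in>(UNIV::'d set). \<epsilon> / d)" using N by (intro sum_strict_mono) auto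
  also have "\<dots> = \<epsilon>" using d by (simp add: d_def)
  finally have small: "(LINT z|torus. (norm (weak_gradient (\<lambda>z. u z - P z) z))\<^sup>2) < \<epsilon>" .
  define I :: "('d \<Rightarrow> int) set" where "I = modes N - {\<lambda>_. 0}"
  define h where "h = (\<lambda>\<kappa> z. wave_coeff u \<kappa> * wave \<kappa> z)"
  have "P = (\<lambda>z. \<Sum>k\<in>I. h k z)"
  proof
    fix z
    show "P z = (\<Sum>k\<in>I. h k z)"
      unfolding P_def partial_sum_def I_def h_def
      by (rule sum.mono_neutral_right) (auto simp: wave_coeff_0_H_space[OF u])
  qed
  moreover have "h k \<in> (\<Union>i. Sigma_space i)" if "k \<in> I" for k
  proof -
    obtain i where "k i \<noteq> 0" using \<open>k \<in> I\<close> by (auto simp: I_def)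
    then have "h k \<in> Sigma_space i" unfolding h_def by (intro Sigma_space_scale wave_in_Sigma_space)
    then show ?thesis by blast
  qed
  moreover have "finite I" by (simp add: I_def)
  ultimately show ?thesis using small by blast
qed

text \<open>
  A nonzero frequency has some component of modulus at least \<open>1\<close>, so each coefficient of \<open>u\<close> is dominated
  by a coefficient of a component of the weak gradient; Bessel's inequality bounds the sum of these.
\<close>

lemma Poincare_inequality:
  fixes u :: "real^'d::finite \<Rightarrow> real"
  assumes u: "u \<in> H_space"
  shows "(LINT z|torus. (u z)\<^sup>2) \<le> (LINT z|torus. (norm (weak_gradient u z))\<^sup>2)"
proof -
  define G where "G = weak_gradient u"
  have uH1: "u \<in> torus_H1" using u by (rule H_space_D)
  note uL2 = torus_H1_D(1)[OF uH1] and uG = torus_H1_D(2)[OF uH1, folded G_def]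
    and GL2 = torus_H1_D(3)[OF uH1, folded G_def]
  have Parseval: "(\<Sum>\<kappa>\<in>modes N. (wave_coeff u \<kappa>)\<^sup>2) \<le> (LINT z|torus. (norm (G z))\<^sup>2)" for N
  proof -
    have "(wave_coeff u \<kappa>)\<^sup>2 \<le> (\<Sum>j\<in>UNIV. (wave_coeff (\<lambda>z. G z $ j) (flip_mode \<kappa> j))\<^sup>2)" for \<kappa>
    proof (cases "\<kappa> = (\<lambda>_. 0)")
      case True
      then show ?thesis by (simp add: wave_coeff_0_H_space[OF u] sum_nonneg)
    next
      case False
      then obtain i where i: "\<kappa> i \<noteq> 0" by auto
      have "1 \<le> \<bar>2 * pi * real_of_int (\<kappa> i)\<bar>"
      proof -
        have "1 \<le> \<bar>real_of_int (\<kappa> i)\<bar>" using i by linarith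
        moreover have "1 \<le> \<bar>2 * pi\<bar>" using pi_gt3 by simp
        ultimately show ?thesis unfolding abs_mult[of "2 * pi"] using mult_mono[of 1 "\<bar>2 * pi\<bar>" 1] by simp
      qed
      then have "1 \<le> (2 * pi * real_of_int (\<kappa> i))\<^sup>2" by (simp add: abs_le_square_iff[of 1, simplified])
      then have "(wave_coeff u \<kappa>)\<^sup>2 \<le> (2 * pi * real_of_int (\<kappa> i))\<^sup>2 * (wave_coeff u \<kappa>)\<^sup>2"
        using mult_right_mono[of 1 _ "(wave_coeff u \<kappa>)\<^sup>2"] by simp
      also have "\<dots> = (wave_coeff (\<lambda>z. G z $ i) (flip_mode \<kappa> i))\<^sup>2"
        unfolding weak_gradient_wave_coeff[OF uL2 uG] by (simp add: power_mult_distrib)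
      also have "\<dots> \<le> (\<Sum>j\<in>UNIV. (wave_coeff (\<lambda>z. G z $ j) (flip_mode \<kappa> j))\<^sup>2)"
        by (rule member_le_sum) auto
      finally show ?thesis .
    qed
    then have "(\<Sum>\<kappa>\<in>modes N. (wave_coeff u \<kappa>)\<^sup>2)
        \<le> (\<Sum>\<kappa>\<in>modes N. \<Sum>j\<in>UNIV. (wave_coeff (\<lambda>z. G z $ j) (flip_mode \<kappa> j))\<^sup>2)" by (rule sum_mono)
    also have "\<dots> = (\<Sum>j\<in>UNIV. \<Sum>\<kappa>\<in>modes N. (wave_coeff (\<lambda>z. G z $ j) (flip_mode \<kappa> j))\<^sup>2)" by (rule sum.swap)
    also have "\<dots> = (\<Sum>j\<in>UNIV. \<Sum>\<kappa>\<in>modes N. (wave_coeff (\<lambda>z. G z $ j) \<kappa>)\<^sup>2)"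
    proof (rule sum.cong[OF refl])
      fix j :: 'd
      show "(\<Sum>\<kappa>\<in>modes N. (wave_coeff (\<lambda>z. G z $ j) (flip_mode \<kappa> j))\<^sup>2) = (\<Sum>\<kappa>\<in>modes N. (wave_coeff (\<lambda>z. G z $ j) \<kappa>)\<^sup>2)"
        by (rule sum.reindex_bij_witness[of _ "\<lambda>\<kappa>. flip_mode \<kappa> j" "\<lambda>\<kappa>. flip_mode \<kappa> j"]) simp_all
    qed
    also have "\<dots> \<le> (\<Sum>j\<in>UNIV. LINT z|torus. (G z $ j)\<^sup>2)"
      by (intro sum_mono Bessel_inequality torus_L2_component GL2)
    finally show ?thesis unfolding integral_norm_square_vec[OF GL2] .
  qed
  show ?thesis
    unfolding G_def[symmetric]
  proof (rule field_le_epsilon)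
    fix \<epsilon> :: real assume "0 < \<epsilon>"
    then obtain N where "(LINT z|torus. (u z - partial_sum N u z)\<^sup>2) < \<epsilon>"
      using partial_sum_converges[OF uL2] by blast
    then have "(LINT z|torus. (u z)\<^sup>2) - (\<Sum>\<kappa>\<in>modes N. (wave_coeff u \<kappa>)\<^sup>2) < \<epsilon>"
      unfolding partial_sum_def dist_trig_sum[OF uL2] by simp
    then show "(LINT z|torus. (u z)\<^sup>2) \<le> (LINT z|torus. (norm (G z))\<^sup>2) + \<epsilon>"
      using Parseval[of N] by linarith
  qed
qed

section \<open>The quadratic functional\<close>

text \<open>
  The hypotheses under which the functional is a coercive quadratic polynomial in the gradient.
\<close>

locale interaction_energy =
  fixes V :: "(real^'p::finite) \<times> (real^'d::finite) \<Rightarrow> real"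
    and K :: "(real^'d) \<times> (real^'d) \<Rightarrow> real"
    and lam :: real
    and \<nu> :: "((real^'p) \<times> (real^'d)) measure"
  assumes V_smooth: "torus_smooth V" and K_smooth: "torus_smooth K"
    and K_nonneg: "\<And>y z. 0 \<le> K (y, z)" and lam_nonneg: "0 \<le> lam"
    and elliptic: "(\<forall>y z. 0 < K (y, z)) \<or> 0 < lam"
    and \<nu>_prob: "torus_prob_measure \<nu>"
begin

text \<open>
  All integrals are kept on the product \<open>M\<close> with points \<open>((q, y), z)\<close>, so that the functional is expanded
  without integrating out \<open>(q, y)\<close>; a function of \<open>z\<close> alone has the same integral over \<open>M\<close> as over the torus.
\<close>

definition M :: "(((real^'p) \<times> (real^'d)) \<times> (real^'d)) measure" where
  "M = \<nu> \<Otimes>\<^sub>M torus"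

definition force :: "(real^'p) \<times> (real^'d) \<Rightarrow> real^'d" where
  "force p = snd (gradient V p)"

definition kern :: "((real^'p) \<times> (real^'d)) \<times> (real^'d) \<Rightarrow> real" where
  "kern x = K (snd (fst x), snd x)"

definition energy_form :: "(real^'d \<Rightarrow> real^'d) \<Rightarrow> (real^'d \<Rightarrow> real^'d) \<Rightarrow> real" where
  "energy_form A B = (LINT x|M. kern x * (A (snd x) \<bullet> B (snd x))) + lam * (LINT z|torus. A z \<bullet> B z)"

definition force_term :: "(real^'d \<Rightarrow> real^'d) \<Rightarrow> real" where
  "force_term A = (LINT x|M. kern x * (force (fst x) \<bullet> A (snd x)))"

definition energy :: "(real^'d \<Rightarrow> real) \<Rightarrow> (real^'d \<Rightarrow> real) \<Rightarrow> real" where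
  "energy f h = energy_form (weak_gradient f) (weak_gradient h)"

lemma prob_space_\<nu>: "prob_space \<nu>" and sets_\<nu>: "sets \<nu> = sets borel"
  using \<nu>_prob by (simp_all add: torus_prob_measure_def)

lemma sets_M: "sets M = sets borel"
  unfolding M_def using sets_pair_measure_cong[OF sets_\<nu> sets_torus] unfolding borel_prod .

lemma measurable_M: "measurable M N = measurable borel N"
  by (rule measurable_cong_sets[OF sets_M refl])

lemma distr_M_snd: "distr M torus snd = (torus :: (real^'d) measure)"
proof (rule measure_eqI)
  interpret \<nu>: prob_space \<nu> by (rule prob_space_\<nu>)
  fix A :: "(real^'d) set" assume "A \<in> sets (distr M torus snd)"
  then have A: "A \<in> sets torus" by simp
  have "snd -` A \<inter> space M = space \<nu> \<times> A" by (auto simp: M_def space_pair_measure)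
  moreover have "snd \<in> measurable M torus" unfolding M_def by (rule measurable_snd)
  ultimately have "emeasure (distr M torus snd) A = emeasure M (space \<nu> \<times> A)"
    using A by (simp add: emeasure_distr)
  also have "\<dots> = emeasure torus A"
    unfolding M_def using A by (subst torus.emeasure_pair_measure_Times) (auto simp: \<nu>.emeasure_space_1)
  finally show "emeasure (distr M torus snd) A = emeasure torus A" .
qed simp

lemma M_snd:
  fixes F :: "real^'d \<Rightarrow> real"
  shows measurable_snd_M: "snd \<in> measurable M torus"
    and integrable_M_snd: "integrable torus F \<Longrightarrow> integrable M (\<lambda>x. F (snd x))"
    and integral_M_snd: "F \<in> borel_measurable torus \<Longrightarrow> (LINT x|M. F (snd x)) = (LINT z|torus. F z)"
    and AE_M_snd: "(AE z in torus. P z) \<Longrightarrow> AE x in M. P (snd x)"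
proof -
  show m: "snd \<in> measurable M torus" unfolding M_def by (rule measurable_snd)
  show "integrable M (\<lambda>x. F (snd x))" if "integrable torus F"
    using integrable_distr[OF m, of F] that unfolding distr_M_snd by blast
  show "(LINT x|M. F (snd x)) = (LINT z|torus. F z)" if "F \<in> borel_measurable torus"
    using integral_distr[OF m that] unfolding distr_M_snd by simp
  show "AE x in M. P (snd x)" if "AE z in torus. P z"
    using AE_distrD[OF m, of P] that unfolding distr_M_snd by blast
qed

lemma finite_measure_M: "finite_measure M"
proof
  have "emeasure M (space M) = emeasure (distr M torus snd) (UNIV :: (real^'d) set)"
    using measurable_snd_M by (subst emeasure_distr) auto
  then show "emeasure M (space M) \<noteq> \<infinity>" unfolding distr_M_snd by simp
qed

text \<open>
  By periodicity \<open>K\<close> attains its minimum \<open>k0\<close>. If \<open>K\<close> is positive everywhere then \<open>k0 > 0\<close>; otherwise \<open>lam > 0\<close>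
  provides the coercivity.
\<close>

lemma K_bounds:
  obtains k0 k1 where "0 \<le> k0" "0 < k0 + lam" "0 \<le> k1" "\<And>x. k0 \<le> kern x" "\<And>x. \<bar>kern x\<bar> \<le> k1"
proof -
  obtain k1 where k1: "0 \<le> k1" "\<And>x. norm (K x) \<le> k1"
    using torus_periodic_continuous_bounded[OF torus_smoothD(1,2)[OF K_smooth]] by blast
  obtain x0 where x0: "\<And>y. y \<in> cbox 0 One \<Longrightarrow> K x0 \<le> K y"
  proof -
    have "\<exists>x\<in>cbox 0 One. \<forall>y\<in>cbox 0 One. K x \<le> K y"
      by (intro continuous_attains_inf compact_cbox continuous_on_subset[OF torus_smoothD(2)[OF K_smooth]])
        (auto simp: box_ne_empty)
    then show ?thesis using that by blast
  qed
  have ge: "K x0 \<le> K x" for x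
    using torus_periodic_representative[OF torus_smoothD(1)[OF K_smooth], of x] x0 by metis
  have "0 \<le> K x0" using K_nonneg by (metis surj_pair)
  moreover have "0 < K x0 + lam"
    using elliptic
  proof
    assume "\<forall>y z. 0 < K (y, z)"
    then have "0 < K x0" by (metis surj_pair)
    with lam_nonneg show ?thesis by simp
  next
    assume "0 < lam"
    with \<open>0 \<le> K x0\<close> show ?thesis by simp
  qed
  ultimately show ?thesis
    using that[of "K x0" k1] k1 ge by (simp add: kern_def)
qed

lemma kern_measurable: "kern \<in> borel_measurable M"
proof -
  have "continuous_on UNIV kern"
    unfolding kern_def[abs_def]
    by (intro continuous_on_compose2[OF torus_smoothD(2)[OF K_smooth]] continuous_intros) auto
  then show ?thesis unfolding measurable_M by (rule borel_measurable_continuous_onI)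
qed

lemma integrable_kern: 
  fixes g :: "_ \<Rightarrow> real"
  assumes "integrable M g"
  shows "integrable M (\<lambda>x. kern x * g x)"
proof -
  obtain k0 k1 where k: "0 \<le> k1" "\<And>x. \<bar>kern x\<bar> \<le> k1" using K_bounds by metis
  show ?thesis
  proof (rule Bochner_Integration.integrable_bound[OF integrable_mult_right[OF integrable_norm[OF assms], of k1]])
    show "(\<lambda>x. kern x * g x) \<in> borel_measurable M"
      by (rule borel_measurable_times[OF kern_measurable borel_measurable_integrable[OF assms]])
    show "AE x in M. norm (kern x * g x) \<le> norm (k1 * norm (g x))"
      using k by (intro AE_I2) (auto simp: abs_mult intro!: mult_right_mono)
  qed
qed

lemma gradient_V: "gradient (\<lambda>y'. V (q, y')) y = force (q, y)"
proof (rule gradient_eqI)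
  have "((\<lambda>y'. V (q, y')) has_derivative (\<lambda>h. (0, h) \<bullet> gradient V (q, y))) (at y)"
    by (rule has_derivative_compose[OF _ torus_smoothD(5)[OF V_smooth], of "\<lambda>y'. (q, y')"])
      (auto intro!: derivative_eq_intros)
  then show "GDERIV (\<lambda>y'. V (q, y')) y :> force (q, y)"
    by (simp add: gderiv_def force_def inner_prod_def)
qed

lemma force_L2:
  "(\<lambda>x. force (fst x)) \<in> borel_measurable M" "integrable M (\<lambda>x. (norm (force (fst x)))\<^sup>2)"
proof -
  have "continuous_on UNIV (\<lambda>x :: ((real^'p) \<times> (real^'d)) \<times> (real^'d). force (fst x))"
    unfolding force_def
    by (intro continuous_on_snd continuous_on_compose2[OF torus_smoothD(6)[OF V_smooth]] continuous_intros) auto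
  then show m: "(\<lambda>x. force (fst x)) \<in> borel_measurable M"
    unfolding measurable_M by (rule borel_measurable_continuous_onI)
  obtain B where B: "\<And>p. norm (gradient V p) \<le> B"
    using torus_periodic_continuous_bounded[OF torus_smoothD(7,6)[OF V_smooth]] by blast
  have "norm (force p) \<le> B" for p
    using norm_snd_le[where x="fst (gradient V p)" and y="snd (gradient V p)"] B[of p]
    unfolding force_def prod.collapse by (rule order_trans)
  then have "(norm (force p))\<^sup>2 \<le> B\<^sup>2" for p by (rule power_mono) simp
  then show "integrable M (\<lambda>x. (norm (force (fst x)))\<^sup>2)"
    using m by (intro finite_measure.integrable_const_bound[OF finite_measure_M, of _ "B\<^sup>2"]) auto
qed

lemma snd_L2:
  assumes "A \<in> torus_L2"
  shows "(\<lambda>x. A (snd x)) \<in> borel_measurable M" "integrable M (\<lambda>x. (norm (A (snd x)))\<^sup>2)"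
proof -
  show "(\<lambda>x. A (snd x)) \<in> borel_measurable M"
    using measurable_compose[OF measurable_snd_M torus_L2_measurable[OF assms]] .
  show "integrable M (\<lambda>x. (norm (A (snd x)))\<^sup>2)"
    using assms by (intro integrable_M_snd) (simp add: torus_L2_def)
qed

lemma kern_inner_integrable:
  assumes "A \<in> torus_L2" "B \<in> torus_L2"
  shows "integrable M (\<lambda>x. kern x * (A (snd x) \<bullet> B (snd x)))"
  using assms by (intro integrable_kern inner_square_integrable snd_L2)

lemma kern_force_integrable:
  assumes "A \<in> torus_L2"
  shows "integrable M (\<lambda>x. kern x * (force (fst x) \<bullet> A (snd x)))"
  using assms by (intro integrable_kern inner_square_integrable snd_L2 force_L2)

lemma energy_form_cong:
  assumes L2: "A \<in> torus_L2" "A' \<in> torus_L2" "B \<in> torus_L2"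
    and eq: "AE z in torus. A z = A' z"
  shows "energy_form A B = energy_form A' B"
proof -
  have "(LINT x|M. kern x * (A (snd x) \<bullet> B (snd x))) = (LINT x|M. kern x * (A' (snd x) \<bullet> B (snd x)))"
  proof (rule integral_cong_AE)
    show "AE x in M. kern x * (A (snd x) \<bullet> B (snd x)) = kern x * (A' (snd x) \<bullet> B (snd x))"
      using AE_M_snd[OF eq] by eventually_elim simp
  qed (intro borel_measurable_integrable kern_inner_integrable L2)+
  moreover have "(LINT z|torus. A z \<bullet> B z) = (LINT z|torus. A' z \<bullet> B z)"
  proof (rule integral_cong_AE)
    show "AE z in torus. A z \<bullet> B z = A' z \<bullet> B z" using eq by eventually_elim simp
  qed (intro borel_measurable_integrable torus_L2_inner_integrable L2)+
  ultimately show ?thesis by (simp add: energy_form_def)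
qed

lemma force_term_cong:
  assumes L2: "A \<in> torus_L2" "A' \<in> torus_L2" and eq: "AE z in torus. A z = A' z"
  shows "force_term A = force_term A'"
  unfolding force_term_def
proof (rule integral_cong_AE)
  show "AE x in M. kern x * (force (fst x) \<bullet> A (snd x)) = kern x * (force (fst x) \<bullet> A' (snd x))"
    using AE_M_snd[OF eq] by eventually_elim simp
qed (intro borel_measurable_integrable kern_force_integrable L2)+

lemma energy_form_add:
  assumes "A \<in> torus_L2" "A' \<in> torus_L2" "B \<in> torus_L2"
  shows "energy_form (\<lambda>z. A z + A' z) B = energy_form A B + energy_form A' B"
  using assms
  by (simp add: energy_form_def inner_add_left distrib_left kern_inner_integrable torus_L2_inner_integrable)

lemma energy_form_scale: "energy_form (\<lambda>z. c *\<^sub>R A z) B = c * energy_form A B"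
  by (simp add: energy_form_def distrib_left mult.left_commute)

lemma force_term_add_scale:
  assumes "A \<in> torus_L2" "B \<in> torus_L2"
  shows "force_term (\<lambda>z. A z + c *\<^sub>R B z) = force_term A + c * force_term B"
proof -
  have "kern x * (force (fst x) \<bullet> (A (snd x) + c *\<^sub>R B (snd x)))
    = kern x * (force (fst x) \<bullet> A (snd x)) + c * (kern x * (force (fst x) \<bullet> B (snd x)))" for x
    by (simp add: inner_add_right distrib_left mult.left_commute)
  then show ?thesis using assms by (simp add: force_term_def kern_force_integrable)
qed

lemma energy_form_bounds:
  obtains \<alpha> \<beta> where "0 < \<alpha>" "0 < \<beta>"
    "\<And>A. A \<in> torus_L2 \<Longrightarrow> \<alpha> * (LINT z|torus. (norm (A z))\<^sup>2) \<le> energy_form A A"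
    "\<And>A. A \<in> torus_L2 \<Longrightarrow> energy_form A A \<le> \<beta> * (LINT z|torus. (norm (A z))\<^sup>2)"
proof -
  \<comment> \<open>The upper constant is taken as \<open>k1 + lam + 1\<close> so that it is positive even for vanishing \<open>k1\<close> and \<open>lam\<close>.\<close>
  obtain k0 k1 where k: "0 \<le> k0" "0 < k0 + lam" "0 \<le> k1" "\<And>x. k0 \<le> kern x" "\<And>x. \<bar>kern x\<bar> \<le> k1"
    using K_bounds by metis
  have "(k0 + lam) * (LINT z|torus. (norm (A z))\<^sup>2) \<le> energy_form A A"
      and "energy_form A A \<le> (k1 + lam + 1) * (LINT z|torus. (norm (A z))\<^sup>2)" if A: "A \<in> torus_L2" for A
  proof -
    let ?n = "LINT z|torus. (norm (A z))\<^sup>2"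
    have n: "(LINT x|M. (norm (A (snd x)))\<^sup>2) = ?n"
    proof (rule integral_M_snd)
      have [measurable]: "A \<in> borel_measurable torus" using A by (rule torus_L2_measurable)
      show "(\<lambda>z. (norm (A z))\<^sup>2) \<in> borel_measurable torus" by measurable
    qed
    have n0: "0 \<le> ?n" by simp
    have form: "energy_form A A = (LINT x|M. kern x * (norm (A (snd x)))\<^sup>2) + lam * ?n"
      by (simp add: energy_form_def power2_norm_eq_inner)
    have int: "integrable M (\<lambda>x. kern x * (norm (A (snd x)))\<^sup>2)" by (intro integrable_kern snd_L2 A)
    have "(LINT x|M. k0 * (norm (A (snd x)))\<^sup>2) \<le> (LINT x|M. kern x * (norm (A (snd x)))\<^sup>2)"
      using k(4) snd_L2(2)[OF A] int by (intro integral_mono mult_right_mono) auto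
    then have "k0 * ?n \<le> (LINT x|M. kern x * (norm (A (snd x)))\<^sup>2)" by (simp add: n)
    then show "(k0 + lam) * ?n \<le> energy_form A A" by (simp add: form distrib_right)
    have "(LINT x|M. kern x * (norm (A (snd x)))\<^sup>2) \<le> (LINT x|M. k1 * (norm (A (snd x)))\<^sup>2)"
      using abs_le_D1[OF k(5)] snd_L2(2)[OF A] int by (intro integral_mono mult_right_mono) auto
    then have "(LINT x|M. kern x * (norm (A (snd x)))\<^sup>2) \<le> k1 * ?n" by (simp add: n)
    then show "energy_form A A \<le> (k1 + lam + 1) * ?n"       using n0 unfolding form distrib_right by linarith
  qed
  then show ?thesis using k lam_nonneg that[of "k0 + lam" "k1 + lam + 1"] by simp
qed

lemma weak_gradient_H_space: "f \<in> H_space \<Longrightarrow> weak_gradient f \<in> torus_L2"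
  by (intro torus_H1_D H_space_D)

sublocale energy: semi_inner_product "H_space :: (real^'d \<Rightarrow> real) set" energy
proof
  show "(\<lambda>x. 0) \<in> (H_space :: (real^'d \<Rightarrow> real) set)"
    using torus_smooth_H1[OF trig_poly_torus_smooth[OF trig_poly_const[of 0]]] by (simp add: H_space_def)
next
  fix f g :: "real^'d \<Rightarrow> real" assume "f \<in> H_space" "g \<in> H_space"
  then show "(\<lambda>x. f x + g x) \<in> H_space" by (rule H_space_add)
next
  fix f :: "real^'d \<Rightarrow> real" and c assume "f \<in> H_space"
  then show "(\<lambda>x. c * f x) \<in> H_space" by (rule H_space_scale)
next
  fix f g
  show "energy f g = energy g f" by (simp add: energy_def energy_form_def inner_commute)
next
  fix f g h :: "real^'d \<Rightarrow> real" assume *: "f \<in> H_space" "g \<in> H_space" "h \<in> H_space"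
  have "energy (\<lambda>x. f x + g x) h = energy_form (\<lambda>x. weak_gradient f x + weak_gradient g x) (weak_gradient h)"
    unfolding energy_def using *
    by (intro energy_form_cong weak_gradient_add torus_L2_add weak_gradient_H_space H_space_add H_space_D)
  also have "\<dots> = energy f h + energy g h"
    unfolding energy_def using * by (intro energy_form_add weak_gradient_H_space)
  finally show "energy (\<lambda>x. f x + g x) h = energy f h + energy g h" .
next
  fix f h :: "real^'d \<Rightarrow> real" and c assume *: "f \<in> H_space" "h \<in> H_space"
  have "energy (\<lambda>x. c * f x) h = energy_form (\<lambda>x. c *\<^sub>R weak_gradient f x) (weak_gradient h)"
    unfolding energy_def using *
    by (intro energy_form_cong weak_gradient_scale torus_L2_scale weak_gradient_H_space H_space_scale H_space_D)
  then show "energy (\<lambda>x. c * f x) h = c * energy f h" by (simp add: energy_form_scale energy_def)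
next
  fix f :: "real^'d \<Rightarrow> real" assume "f \<in> H_space"
  then have L2: "weak_gradient f \<in> torus_L2" by (rule weak_gradient_H_space)
  obtain \<alpha> where \<alpha>: "0 < \<alpha>" "\<alpha> * (LINT z|torus. (norm (weak_gradient f z))\<^sup>2) \<le> energy f f"
    using energy_form_bounds L2 unfolding energy_def by metis
  have "0 \<le> \<alpha> * (LINT z|torus. (norm (weak_gradient f z))\<^sup>2)" using \<alpha>(1) by simp
  then show "0 \<le> energy f f" using \<alpha>(2) by (rule order_trans)
qed

lemma J_functional_eq:
  assumes "f \<in> H_space"
  shows "J_functional V K lam \<nu> f
    = (LINT x|M. kern x * (norm (force (fst x)))\<^sup>2) - 2 * force_term (weak_gradient f) + energy f f"
proof -
  define G where "G = weak_gradient f"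
  have G: "G \<in> torus_L2" unfolding G_def by (rule weak_gradient_H_space[OF assms])
  have "J_functional V K lam \<nu> f
    = (LINT x|M. kern x * (norm (force (fst x)))\<^sup>2 - 2 * (kern x * (force (fst x) \<bullet> G (snd x)))
        + kern x * (G (snd x) \<bullet> G (snd x))) + lam * (LINT z|torus. G z \<bullet> G z)"
    unfolding J_functional_def gradient_V G_def[symmetric] M_def[symmetric]
    by (intro arg_cong2[where f="(+)"] arg_cong2[where f="(*)"] Bochner_Integration.integral_cong refl)
      (auto simp: kern_def power2_norm_eq_inner inner_diff_left inner_diff_right inner_commute algebra_simps)
  also have "\<dots> = (LINT x|M. kern x * (norm (force (fst x)))\<^sup>2) - 2 * force_term G + energy_form G G"
    using integrable_kern[OF force_L2(2)] kern_force_integrable[OF G] kern_inner_integrable[OF G G]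
    by (simp add: force_term_def energy_form_def)
  finally show ?thesis by (simp add: G_def energy_def)
qed

lemma J_functional_minimizer:
  assumes min: "is_arg_min (J_functional V K lam \<nu>) (\<lambda>h. h \<in> H_space) fs" and f: "f \<in> H_space"
  shows "J_functional V K lam \<nu> f = J_functional V K lam \<nu> fs + energy (\<lambda>x. f x - fs x) (\<lambda>x. f x - fs x)"
proof (rule energy.quadratic_minimizer[OF J_functional_eq _ min f])
  fix f g :: "real^'d \<Rightarrow> real" and t assume fg: "f \<in> H_space" "g \<in> H_space"
  note tg = H_space_scale[OF fg(2), of t]
  have "AE z in torus. weak_gradient (\<lambda>x. f x + t * g x) z = weak_gradient f z + t *\<^sub>R weak_gradient g z"
    using weak_gradient_add[OF H_space_D[OF fg(1)] H_space_D[OF tg]] weak_gradient_scale[OF H_space_D[OF fg(2)], of t]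
    by eventually_elim simp
  then have "force_term (weak_gradient (\<lambda>x. f x + t * g x))
    = force_term (\<lambda>z. weak_gradient f z + t *\<^sub>R weak_gradient g z)"
    using fg tg by (intro force_term_cong weak_gradient_H_space torus_L2_add torus_L2_scale H_space_add)
  then show "force_term (weak_gradient (\<lambda>x. f x + t * g x))
    = force_term (weak_gradient f) + t * force_term (weak_gradient g)"
    using fg by (simp add: force_term_add_scale weak_gradient_H_space)
qed

text \<open>
  Density in the gradient norm is density in the energy norm, by the upper bound on the form.
\<close>

lemma Sigma_space_total:
  assumes v: "v \<in> H_space" and "0 < \<epsilon>"
  shows "\<exists>(I :: ('d \<Rightarrow> int) set) h. finite I \<and> (\<forall>k\<in>I. h k \<in> (\<Union>i. Sigma_space i)) \<and>
    energy.nrm (\<lambda>z. v z - (\<Sum>k\<in>I. h k z)) < \<epsilon>"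
proof -
  obtain \<beta> where \<beta>: "0 < \<beta>" "\<And>A. A \<in> torus_L2 \<Longrightarrow> energy_form A A \<le> \<beta> * (LINT z|torus. (norm (A z))\<^sup>2)"
    using energy_form_bounds by metis
  have "0 < \<epsilon>\<^sup>2 / \<beta>" using \<open>0 < \<epsilon>\<close> \<beta>(1) by simp
  then obtain I :: "('d \<Rightarrow> int) set" and h where I: "finite I" "\<forall>k\<in>I. h k \<in> (\<Union>i. Sigma_space i)"
    and small: "(LINT z|torus. (norm (weak_gradient (\<lambda>z. v z - (\<Sum>k\<in>I. h k z)) z))\<^sup>2) < \<epsilon>\<^sup>2 / \<beta>"
    using Sigma_space_dense[OF v] by blast
  have "h k \<in> H_space" if "k \<in> I" for k using I(2) that by (auto simp: Sigma_space_def)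
  then have mem: "(\<lambda>z. v z - (\<Sum>k\<in>I. h k z)) \<in> H_space"
    by (intro energy.diff_mem[OF v] energy.sum_mem) blast
  have "energy (\<lambda>z. v z - (\<Sum>k\<in>I. h k z)) (\<lambda>z. v z - (\<Sum>k\<in>I. h k z))
    \<le> \<beta> * (LINT z|torus. (norm (weak_gradient (\<lambda>z. v z - (\<Sum>k\<in>I. h k z)) z))\<^sup>2)"
    unfolding energy_def by (rule \<beta>(2)[OF weak_gradient_H_space[OF mem]])
  also have "\<dots> < \<epsilon>\<^sup>2" using small \<beta>(1) by (simp add: pos_less_divide_eq mult.commute)
  finally have "energy.nrm (\<lambda>z. v z - (\<Sum>k\<in>I. h k z)) < sqrt (\<epsilon>\<^sup>2)"
    unfolding energy.nrm_def by (rule real_sqrt_less_mono)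
  with I show ?thesis using \<open>0 < \<epsilon>\<close> by auto
qed

lemma H1_norm_le_energy:
  obtains C where "\<And>u. u \<in> H_space \<Longrightarrow> H1_norm u \<le> sqrt (C * energy u u)"
proof -
  obtain \<alpha> where \<alpha>: "0 < \<alpha>" "\<And>A. A \<in> torus_L2 \<Longrightarrow> \<alpha> * (LINT z|torus. (norm (A z))\<^sup>2) \<le> energy_form A A"
    using energy_form_bounds by metis
  have "H1_norm u \<le> sqrt (2 / \<alpha> * energy u u)" if u: "u \<in> H_space" for u
  proof -
    have "\<alpha> * (LINT z|torus. (norm (weak_gradient u z))\<^sup>2) \<le> energy u u"
      unfolding energy_def by (rule \<alpha>(2)[OF weak_gradient_H_space[OF u]])
    then have "(LINT z|torus. (norm (weak_gradient u z))\<^sup>2) \<le> energy u u / \<alpha>"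
      using \<alpha>(1) by (simp add: pos_le_divide_eq mult.commute)
    then show ?thesis
      unfolding H1_norm_def using Poincare_inequality[OF u] by (intro real_sqrt_le_mono) simp
  qed
  then show ?thesis by (rule that)
qed

end

section \<open>Convergence of the greedy algorithm\<close>

theorem theorem5:
  fixes V :: "(real^'p::finite) \<times> (real^'d::finite) \<Rightarrow> real"
    and K :: "(real^'d) \<times> (real^'d) \<Rightarrow> real"
    and lam :: real
    and \<nu> :: "((real^'p) \<times> (real^'d)) measure"
    and e :: "nat \<Rightarrow> 'd"
    and f :: "nat \<Rightarrow> real^'d \<Rightarrow> real"
    and f0 fstar :: "real^'d \<Rightarrow> real"
  assumes "CARD('p) + CARD('d) \<ge> 3"
    and "torus_smooth V"
    and "lam \<ge> 0"
    and "torus_smooth K"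
    and "\<And>y z. K (y, z) \<ge> 0"
    and "\<And>y. (LINT z|torus. K (y, z)) = 1"
    and "\<And>y z. K (y, z) = K (z, y)"
    and "(\<forall>y z. K (y, z) > 0) \<or> lam > 0"
    and "torus_prob_measure \<nu>"
    and "bij_betw e {..<CARD('d)} UNIV"
    and "f0 \<in> H_space"
    and "is_arg_min (J_functional V K lam \<nu>) (\<lambda>h. h \<in> H_space) fstar"
    and "f 0 = f0"
    and "greedy_sequence (J_functional V K lam \<nu>) e f"
  shows "(\<lambda>m. H1_norm (\<lambda>z. f m z - fstar z)) \<longlonglongrightarrow> 0"
proof -
  interpret interaction_energy V K lam \<nu>
    using assms(2-5,8,9) by unfold_locales auto
  let ?J = "J_functional V K lam \<nu>"
  have fs: "fstar \<in> H_space" using assms(12) by (simp add: is_arg_min_def)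
  let ?step = "\<lambda>n g. is_arg_min (\<lambda>h. ?J (\<lambda>z. f n z + h z)) (\<lambda>h. h \<in> Sigma_space (e (n mod CARD('d)))) g
      \<and> f (Suc n) = (\<lambda>z. f n z + g z)"
  have "\<forall>n. \<exists>g. ?step n g" using assms(14) unfolding greedy_sequence_def .
  then obtain g where greedy: "\<forall>n. ?step n (g n)" by (rule choice[THEN exE])
  have g: "is_arg_min (\<lambda>h. ?J (\<lambda>z. f n z + h z)) (\<lambda>h. h \<in> Sigma_space (e (n mod CARD('d)))) (g n)"
    and step: "f (Suc n) = (\<lambda>z. f n z + g n z)" for n
    using greedy[rule_format, of n] by (rule conjunct1, rule conjunct2)
  have gS: "g n \<in> Sigma_space (e (n mod CARD('d)))" for n
    using g[of n] by (simp add: is_arg_min_def)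
  have SH: "Sigma_space i \<subseteq> H_space" for i :: 'd by (auto simp: Sigma_space_def)
  have fH: "f n \<in> H_space" for n
    by (induction n) (use assms(11,13) gS SH in \<open>auto simp: step intro!: H_space_add\<close>)
  define u where "u n = (\<lambda>z. f n z - fstar z)" for n
  have uH: "u n \<in> H_space" for n unfolding u_def by (intro energy.diff_mem fH fs)
  have "(\<lambda>n. energy (u n) (u n)) \<longlonglongrightarrow> 0"
  proof (rule energy.greedy_convergence[where D=Sigma_space and d="CARD('d)" and e=e and g=g])
    show "0 < CARD('d)" by simp
    show "\<exists>k<CARD('d). e k = i" for i
      using bij_betw_imp_surj_on[OF assms(10)] by (metis UNIV_I imageE lessThan_iff)
    show "Sigma_space i \<subseteq> H_space" for i :: 'd by (rule SH)
    show "h \<in> Sigma_space i \<Longrightarrow> (\<lambda>x. c * h x) \<in> Sigma_space i" for i :: 'd and h c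
      by (rule Sigma_space_scale)
    show "\<exists>(I :: ('d \<Rightarrow> int) set) h. finite I \<and> (\<forall>k\<in>I. h k \<in> (\<Union>i. Sigma_space i)) \<and>
        energy.nrm (\<lambda>x. v x - (\<Sum>k\<in>I. h k x)) < \<epsilon>" if "v \<in> H_space" "0 < \<epsilon>" for v \<epsilon>
      by (rule Sigma_space_total[OF that])
    show "u 0 \<in> H_space" by (rule uH)
    show "g n \<in> Sigma_space (e (n mod CARD('d)))" for n by (rule gS)
    show "u (Suc n) = (\<lambda>x. u n x + g n x)" for n by (simp add: u_def step fun_eq_iff)
    show "energy (u (Suc n)) (u (Suc n)) \<le> energy (\<lambda>x. u n x + h x) (\<lambda>x. u n x + h x)"
      if h: "h \<in> Sigma_space (e (n mod CARD('d)))" for n h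
    proof -
      have hH: "h \<in> H_space" using h SH by blast
      have "?J (f (Suc n)) \<le> ?J (\<lambda>z. f n z + h z)"
        using g[of n] h by (simp add: is_arg_min_def step not_less)
      then have "energy (u (Suc n)) (u (Suc n))
          \<le> energy (\<lambda>z. (f n z + h z) - fstar z) (\<lambda>z. (f n z + h z) - fstar z)"
        using J_functional_minimizer[OF assms(12) fH, of "Suc n"]
          J_functional_minimizer[OF assms(12) H_space_add[OF fH hH], of n] by (simp add: u_def)
      then show ?thesis by (simp add: u_def add_diff_eq diff_add_eq)
    qed
  qed
  obtain C where C: "\<And>u. u \<in> H_space \<Longrightarrow> H1_norm u \<le> sqrt (C * energy u u)"
    using H1_norm_le_energy by blast
  have "(\<lambda>n. sqrt (C * energy (u n) (u n))) \<longlonglongrightarrow> sqrt (C * 0)"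
    by (intro tendsto_intros) fact
  then have lim: "(\<lambda>n. sqrt (C * energy (u n) (u n))) \<longlonglongrightarrow> 0" by simp
  show ?thesis
  proof (rule tendsto_sandwich[OF _ _ tendsto_const lim])
    show "\<forall>\<^sub>F n in sequentially. 0 \<le> H1_norm (\<lambda>z. f n z - fstar z)"
      by (simp add: H1_norm_def)
    show "\<forall>\<^sub>F n in sequentially. H1_norm (\<lambda>z. f n z - fstar z) \<le> sqrt (C * energy (u n) (u n))"
      using C[OF uH] by (simp add: u_def)
  qed
qed

end
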